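(* There exists $\Delta_0$ such that $\chi'_{\rm pOCF}(G)\le\Delta+2\log_2\Delta$ for every finite simple graph $G$ with maximum degree $\Delta\ge\Delta_0$ and minimum degree $\delta\ge\Delta-2\sqrt{\Delta}\,\log_2\Delta$.
   Context: For an edge colouring $c:E\to\mathbb{N}$ of a graph $G=(V,E)$ and an edge $uv$, the open neighbourhood of $uv$ is $E_G(uv)=(E_G(u)\cup E_G(v))\setminus\{uv\}$, where $E_G(x)$ is the set of edges incident with $x$; the edge $uv$ is satisfied if some colour appears on exactly one edge of $E_G(uv)$. An open conflict-free edge colouring is one in which every non-isolated edge is satisfied. $\chi'_{\rm pOCF}(G)$ is the minimum number of colours in an open conflict-free edge colouring of $G$ which is additionally proper (adjacent edges receive distinct colours). *)

theory Defs
  imports Complex_Main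
begin

text \<open>A finite simple graph is a pair of a finite vertex set and a set of two-element
  subsets of it (the edges).\<close>

definition simple_graph :: "'a set \<Rightarrow> 'a set set \<Rightarrow> bool" where
  "simple_graph V E \<longleftrightarrow> finite V \<and> (\<forall>e\<in>E. e \<subseteq> V \<and> card e = 2)"

definition incident_edges :: "'a set set \<Rightarrow> 'a \<Rightarrow> 'a set set" where
  "incident_edges E x = {e \<in> E. x \<in> e}"

definition vertex_degree :: "'a set set \<Rightarrow> 'a \<Rightarrow> nat" where
  "vertex_degree E x = card (incident_edges E x)"

text \<open>The maximum and minimum degree are meaningful only for nonempty \<open>V\<close>.\<close>

definition max_degree :: "'a set \<Rightarrow> 'a set set \<Rightarrow> nat" where
  "max_degree V E = Max (vertex_degree E ` V)"

definition min_degree :: "'a set \<Rightarrow> 'a set set \<Rightarrow> nat" where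
  "min_degree V E = Min (vertex_degree E ` V)"

definition open_edge_nbhd :: "'a set set \<Rightarrow> 'a set \<Rightarrow> 'a set set" where
  "open_edge_nbhd E e = (\<Union>x\<in>e. incident_edges E x) - {e}"

text \<open>An edge colouring is a function on all of \<open>'a set\<close>; only its values on \<open>E\<close> matter.\<close>

definition edge_satisfied :: "'a set set \<Rightarrow> ('a set \<Rightarrow> nat) \<Rightarrow> 'a set \<Rightarrow> bool" where
  "edge_satisfied E c e \<longleftrightarrow> (\<exists>a. \<exists>!f. f \<in> open_edge_nbhd E e \<and> c f = a)"

definition isolated_edge :: "'a set set \<Rightarrow> 'a set \<Rightarrow> bool" where
  "isolated_edge E e \<longleftrightarrow> open_edge_nbhd E e = {}"

definition open_conflict_free :: "'a set set \<Rightarrow> ('a set \<Rightarrow> nat) \<Rightarrow> bool" where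
  "open_conflict_free E c \<longleftrightarrow> (\<forall>e\<in>E. \<not> isolated_edge E e \<longrightarrow> edge_satisfied E c e)"

definition proper_edge_colouring :: "'a set set \<Rightarrow> ('a set \<Rightarrow> nat) \<Rightarrow> bool" where
  "proper_edge_colouring E c \<longleftrightarrow>
     (\<forall>e\<in>E. \<forall>f\<in>E. e \<noteq> f \<and> e \<inter> f \<noteq> {} \<longrightarrow> c e \<noteq> c f)"

text \<open>For finite \<open>E\<close> the minimum below is over a nonempty set, since an injective colouring
  is proper and open conflict-free (lemma \<open>pOCF_index_attained\<close>).\<close>

definition pOCF_index :: "'a set set \<Rightarrow> nat" where
  "pOCF_index E = (LEAST k. \<exists>c :: 'a set \<Rightarrow> nat.
     proper_edge_colouring E c \<and> open_conflict_free E c \<and> card (c ` E) = k)"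

lemma pOCF_index_attained:
  assumes "finite E"
  shows "\<exists>c. proper_edge_colouring E c \<and> open_conflict_free E c \<and> card (c ` E) = pOCF_index E"
proof -
  obtain c :: "'a set \<Rightarrow> nat" where c: "inj_on c E"
    using finite_imp_inj_to_nat_seg[OF assms] by blast
  have sub: "open_edge_nbhd E e \<subseteq> E" for e
    by (auto simp: open_edge_nbhd_def incident_edges_def)
  have "proper_edge_colouring E c"
    using c by (auto simp: proper_edge_colouring_def dest: inj_onD)
  moreover have "open_conflict_free E c"
    unfolding open_conflict_free_def isolated_edge_def edge_satisfied_def
  proof (intro ballI impI)
    fix e assume "open_edge_nbhd E e \<noteq> {}"
    then obtain f where f: "f \<in> open_edge_nbhd E e" by blast
    have "\<exists>!g. g \<in> open_edge_nbhd E e \<and> c g = c f"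
      using f c sub by (metis inj_onD subsetD)
    then show "\<exists>a. \<exists>!g. g \<in> open_edge_nbhd E e \<and> c g = a" by blast
  qed
  ultimately have "\<exists>c :: 'a set \<Rightarrow> nat. proper_edge_colouring E c \<and> open_conflict_free E c
      \<and> card (c ` E) = card (c ` E)" by blast
  then have "\<exists>k. \<exists>c :: 'a set \<Rightarrow> nat.
      proper_edge_colouring E c \<and> open_conflict_free E c \<and> card (c ` E) = k" by blast
  then show ?thesis
    unfolding pOCF_index_def by (rule LeastI_ex)
qed

end

theory Submission
  imports Defs "HOL-Library.FuncSet" "HOL-Combinatorics.Transposition" "HOL-Real_Asymp.Real_Asymp"
begin

text \<open>In a proper colouring an edge \<open>uv\<close> is satisfied as soon as the palettes at \<open>u\<close> and \<open>v\<close> differ.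
  Start from a colouring \<open>c\<close> with \<open>\<Delta> + 1\<close> colours given by Vizing's theorem, and let every vertex pick six
  of its edges uniformly at random. The set \<open>H\<close> of picked edges is recoloured with new colours. Given all
  other picks, the old colours left at \<open>u\<close> agree with those left at a neighbour with probability only
  \<open>(log \<Delta> / \<Delta>)\<^sup>6\<close> up to a constant, and \<open>2 log\<^sub>2 \<Delta> - 8\<close> or more edges at \<open>u\<close> are picked by
  neighbours with probability smaller than any power of \<open>1 / \<Delta>\<close>. By the local lemma all these
  events can be avoided at once, and Vizing's theorem colours \<open>H\<close> with at most
  \<open>2 log\<^sub>2 \<Delta> - 1\<close> new colours.\<close>

section \<open>Vizing's theorem\<close>

text \<open>The local lemma dictates the number six. A bad event belongs to a vertex and looks only
  at picks made within distance 2, so it interferes with at most \<open>(\<Delta> + 1) ^ 4\<close>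
  events; it also unites the conflicts with up to \<Delta> neighbours. Agreement of two palettes
  must therefore be rarer than \<Delta> to the power -5. Six picks achieve this, while five would
  miss it by a power of the logarithm. Edges are picked by vertices, with repetition, so that the
  sample space is a product of uniform choices in which \<open>u\<close> keeps six free choices once
  all others are fixed. The price is that \<open>u\<close> has no control over the picks that hit
  it. Their expected number is at most 12, because the minimum degree is at least \<Delta> / 2, so a
  threshold of order log \<Delta> is rarely reached.\<close>

text \<open>The orbit of \<open>x\<close> is a component of the union of two matchings. Since
  \<open>s\<close> fixes \<open>x\<close>, it is a path that begins at \<open>x\<close>, and such a
  path has at most one other end.\<close>

lemma involutions_orbit_ends:
  fixes s t :: "'a \<Rightarrow> 'a"
  assumes s: "\<And>x. s (s x) = x" and t: "\<And>x. t (t x) = x"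
  defines "R \<equiv> {(x, y). y = s x \<or> y = t x}"
  assumes x: "s x = x"
    and y: "(x, y) \<in> R\<^sup>*" "s y = y \<or> t y = y" "y \<noteq> x"
    and z: "(x, z) \<in> R\<^sup>*" "s z = z \<or> t z = z" "z \<noteq> x"
  shows "y = z"
proof -
  \<comment> \<open>As \<open>s\<close> fixes \<open>x\<close>, the only way out is
    \<open>t\<close>; from then on the two maps alternate.\<close>
  define w where "w = rec_nat x (\<lambda>n a. if even n then t a else s a)"
  have w0: "w 0 = x"
    by (simp add: w_def)
  have wS: "w (Suc n) = (if even n then t (w n) else s (w n))" for n
    by (simp add: w_def)
  \<comment> \<open>\<open>S\<close> collects the indices before which no step has stalled. A vertex
    \<open>w m\<close> with \<open>m\<close> in \<open>S\<close>, other than \<open>x\<close>, moves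
    when it steps back, so a map that fixes it must be the next one to be applied. The ends thus are
    the places where the walk stalls for the first time, and there is only one.\<close>
  define S where "S = {m. \<forall>k<m. w (Suc k) \<noteq> w k}"
  have turn: "(if even (Suc n) then t (w (Suc n)) else s (w (Suc n))) = w (Suc (Suc n))"
    "(if even (Suc n) then s (w (Suc n)) else t (w (Suc n))) = w n" for n
    using s t wS by simp_all
  have Sdown: "m \<in> S" if "Suc m \<in> S" for m
    using that by (auto simp: S_def)
  have Sup: "w (Suc m) \<in> w ` S" if "m \<in> S" for m
  proof (cases "w (Suc m) = w m")
    case True
    then show ?thesis using that by simp
  next
    case False
    then have "Suc m \<in> S" using that by (auto simp: S_def less_Suc_eq)
    then show ?thesis by simp
  qed
  have closed: "s (w m) \<in> w ` S \<and> t (w m) \<in> w ` S" if m: "m \<in> S" for m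
  proof (cases m)
    case 0
    then show ?thesis using x w0 wS[of 0] Sup[OF m] m by (metis even_zero imageI)
  next
    case (Suc n)
    have "w n \<in> w ` S" using Sdown m Suc by blast
    then show ?thesis using turn[of n] Sup[OF m] Suc by (metis (full_types))
  qed
  have orbit: "a \<in> w ` S" if "(x, a) \<in> R\<^sup>*" for a
    using that
  proof induction
    case base
    have "0 \<in> S" by (simp add: S_def)
    then show ?case using w0 by force
  next
    case (step a b)
    then show ?case using closed by (auto simp: R_def)
  qed
  have fin: "\<exists>m\<in>S. a = w m \<and> w (Suc m) = w m"
    if a: "(x, a) \<in> R\<^sup>*" "s a = a \<or> t a = a" "a \<noteq> x" for a
  proof -
    obtain m where m: "m \<in> S" "a = w m" using orbit[OF a(1)] by blast
    obtain n where n: "m = Suc n" using a(3) w0 m(2) by (cases m) auto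
    have "w (Suc n) \<noteq> w n" using m(1) n by (auto simp: S_def)
    then have "w (Suc m) = w m" using turn[of n] a(2) m(2) n by (metis (full_types))
    then show ?thesis using m by blast
  qed
  obtain m n where mn: "m \<in> S" "y = w m" "w (Suc m) = w m" "n \<in> S" "z = w n" "w (Suc n) = w n"
    using fin[OF y] fin[OF z] by blast
  then have "\<not> m < n" "\<not> n < m" by (auto simp: S_def)
  then show ?thesis using mn by (metis linorder_neqE_nat)
qed

section \<open>Kempe chains\<close>

definition absent_colours :: "'a set set \<Rightarrow> ('a set \<Rightarrow> 'b) \<Rightarrow> 'a \<Rightarrow> 'b set" where
  "absent_colours F c x = - c ` incident_edges F x"

lemma proper_edge_colouringD:
  assumes "proper_edge_colouring F c" "e \<in> F" "f \<in> F" "x \<in> e" "x \<in> f" "c e = c f"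
  shows "e = f"
  using assms unfolding proper_edge_colouring_def by blast

text \<open>Two colour classes are two matchings; \<open>C x\<close> is the component of
  \<open>x\<close> in their union. Its ends are the vertices at which \<open>i\<close> or
  \<open>j\<close> is absent, and the last property says that there are at most two of them.\<close>

lemma kempe_chains:
  fixes F :: "'a set set" and c :: "'a set \<Rightarrow> nat"
  assumes F: "\<forall>e\<in>F. card e = 2" and proper: "proper_edge_colouring F c"
  obtains C :: "'a \<Rightarrow> 'a set" where
    "\<And>x. x \<in> C x"
    "\<And>x y. y \<in> C x \<Longrightarrow> C y = C x"
    "\<And>x e. e \<in> F \<Longrightarrow> c e \<in> {i, j} \<Longrightarrow> e \<inter> C x \<noteq> {} \<Longrightarrow> e \<subseteq> C x"
    "\<And>x. {i, j} \<subseteq> absent_colours F c x \<Longrightarrow> C x = {x}"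
    "\<And>x y z. y \<in> C x \<Longrightarrow> z \<in> C x \<Longrightarrow> x \<noteq> y \<Longrightarrow> x \<noteq> z \<Longrightarrow>
       {i, j} \<inter> absent_colours F c x \<noteq> {} \<Longrightarrow> {i, j} \<inter> absent_colours F c y \<noteq> {} \<Longrightarrow>
       {i, j} \<inter> absent_colours F c z \<noteq> {} \<Longrightarrow> y = z"
proof -
  \<comment> \<open>\<open>p k\<close> exchanges the ends of every edge of colour \<open>k\<close>
    and fixes the vertices at which \<open>k\<close> is absent. It is well defined because the
    colouring is proper.\<close>
  define p where "p k x = (if \<exists>y. {x, y} \<in> F \<and> c {x, y} = k
      then SOME y. {x, y} \<in> F \<and> c {x, y} = k else x)" for k x
  have uniq: "y = z" if "{x, y} \<in> F" "c {x, y} = k" "{x, z} \<in> F" "c {x, z} = k" for x y z k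
  proof -
    have "{x, y} = {x, z}" using proper_edge_colouringD[OF proper that(1,3)] that by auto
    then show ?thesis by (auto simp: doubleton_eq_iff)
  qed
  have p_eq: "p k x = y" if "{x, y} \<in> F" "c {x, y} = k" for k x y
    using someI[of "\<lambda>y. {x, y} \<in> F \<and> c {x, y} = k", OF conjI[OF that]] uniq that
    unfolding p_def by (auto intro: uniq)
  have p_absent: "p k x = x" if "k \<in> absent_colours F c x" for k x
    using that by (auto simp: p_def absent_colours_def incident_edges_def)
  have inv: "p k (p k x) = x" for k x
  proof (cases "\<exists>y. {x, y} \<in> F \<and> c {x, y} = k")
    case True
    then obtain y where y: "{x, y} \<in> F" "c {x, y} = k" by blast
    then show ?thesis using p_eq[OF y] p_eq[of y x k] by (simp add: insert_commute)
  next
    case False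
    then have "p k x = x" unfolding p_def by (rule if_not_P)
    then show ?thesis by simp
  qed
  define R where "R = {(x, y). y = p i x \<or> y = p j x}"
  have "sym R" using inv by (auto simp: R_def sym_def)
  then have symR: "sym (R\<^sup>*)" by (rule sym_rtrancl)
  define C where "C x = R\<^sup>* `` {x}" for x
  have R_eq: "R = {(x, y). y = p j x \<or> y = p i x}" by (auto simp: R_def)
  show ?thesis
  proof (rule that[of C])
    show "x \<in> C x" for x by (simp add: C_def)
    show "C y = C x" if "y \<in> C x" for x y
    proof -
      have "(x, y) \<in> R\<^sup>*" "(y, x) \<in> R\<^sup>*" using that symD[OF symR] by (auto simp: C_def)
      then show ?thesis by (auto simp: C_def intro: rtrancl_trans)
    qed
    show "e \<subseteq> C x" if e: "e \<in> F" "c e \<in> {i, j}" "e \<inter> C x \<noteq> {}" for x e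
    proof -
      obtain a where a: "a \<in> e" "a \<in> C x" using e(3) by blast
      obtain b where b: "e = {a, b}"
        using bspec[OF F e(1)] a(1) by (auto simp: card_2_iff insert_commute)
      have "b = p i a \<or> b = p j a" using p_eq[of a b] e b by auto
      then have "(a, b) \<in> R" by (simp add: R_def)
      then have "b \<in> C x" using a(2) by (auto simp: C_def)
      then show ?thesis using a b by simp
    qed
    show "C x = {x}" if "{i, j} \<subseteq> absent_colours F c x" for x
    proof -
      have "y = x" if "(x, y) \<in> R\<^sup>*" for y
        using that
      proof induction
        case (step y z)
        then show ?case using p_absent \<open>{i, j} \<subseteq> _\<close> by (auto simp: R_def)
      qed simp
      then show ?thesis by (auto simp: C_def)
    qed
    show "y = z" if yz: "y \<in> C x" "z \<in> C x" "x \<noteq> y" "x \<noteq> z"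
      and ends: "{i, j} \<inter> absent_colours F c x \<noteq> {}" "{i, j} \<inter> absent_colours F c y \<noteq> {}"
        "{i, j} \<inter> absent_colours F c z \<noteq> {}" for x y z
    proof -
      have fixed: "p i a = a \<or> p j a = a" if "{i, j} \<inter> absent_colours F c a \<noteq> {}" for a
        using that p_absent by blast
      show ?thesis
      proof (cases "p i x = x")
        case True
        then show ?thesis
          using involutions_orbit_ends[of "p i" "p j" x y z, OF inv inv] yz fixed ends
          by (auto simp: C_def R_def)
      next
        case False
        then have "p j x = x" using fixed ends by blast
        then show ?thesis
          using involutions_orbit_ends[of "p j" "p i" x y z, OF inv inv] yz fixed ends
          by (auto simp: C_def R_eq)
      qed
    qed
  qed
qed

text \<open>All edges at a vertex are recoloured by the same bijection, the transposition or the
  identity. Edges that leave \<open>C\<close> cause no ambiguity, since their colours are fixed by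
  the transposition.\<close>

lemma kempe_swap:
  fixes F :: "'a set set" and c :: "'a set \<Rightarrow> nat"
  assumes proper: "proper_edge_colouring F c"
    and closed: "\<And>e. e \<in> F \<Longrightarrow> c e \<in> {i, j} \<Longrightarrow> e \<inter> C \<noteq> {} \<Longrightarrow> e \<subseteq> C"
  defines "d \<equiv> \<lambda>e. if e \<inter> C \<noteq> {} then transpose i j (c e) else c e"
  shows "proper_edge_colouring F d"
    and "absent_colours F d x = (if x \<in> C then transpose i j ` absent_colours F c x
           else absent_colours F c x)"
proof -
  have d_at: "d e = (if x \<in> C then transpose i j (c e) else c e)" if "e \<in> F" "x \<in> e" for e x
    using closed[OF that(1)] that(2)
    by (cases "c e \<in> {i, j}") (auto simp: d_def transpose_def)
  show "proper_edge_colouring F d"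
    unfolding proper_edge_colouring_def
  proof (intro ballI impI)
    fix e f assume ef: "e \<in> F" "f \<in> F" "e \<noteq> f \<and> e \<inter> f \<noteq> {}"
    then obtain x where x: "x \<in> e" "x \<in> f" by blast
    have "c e \<noteq> c f" using proper ef unfolding proper_edge_colouring_def by blast
    then show "d e \<noteq> d f"
      using d_at[OF ef(1) x(1)] d_at[OF ef(2) x(2)]
        injD[OF bij_is_inj[OF bij_transpose], of i j "c e" "c f"] by auto
  qed
  have "d ` incident_edges F x = (if x \<in> C then transpose i j ` c ` incident_edges F x
      else c ` incident_edges F x)"
    using d_at[of _ x] by (auto simp: incident_edges_def image_iff)
  then show "absent_colours F d x = (if x \<in> C then transpose i j ` absent_colours F c x
      else absent_colours F c x)"
    by (simp add: absent_colours_def bij_image_Compl_eq)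
qed

text \<open>This is the descent step for the sum of squares in \<open>extend_edge_colouring\<close>.
  A chain with a vertex that stocks \<open>i\<close> and none that stocks \<open>j\<close> is
  swapped, and the stocks are swapped along with it. The gap 3 exceeds the largest shift 2, which
  makes the descent strict.\<close>

lemma kempe_balance:
  fixes F :: "'a set set" and c :: "'a set \<Rightarrow> nat" and A :: "'a \<Rightarrow> nat set"
  assumes F: "\<forall>e\<in>F. card e = 2" and proper: "proper_edge_colouring F c"
    and cK: "c ` F \<subseteq> K" and ij: "i \<in> K" "j \<in> K"
    and U: "finite U" and A: "\<forall>u\<in>U. A u \<subseteq> K \<inter> absent_colours F c u"
    and gap: "card {u \<in> U. i \<in> A u} \<ge> card {u \<in> U. j \<in> A u} + 3"
  obtains d B \<delta> where "proper_edge_colouring F d" "d ` F \<subseteq> K"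
    "\<And>u. u \<in> U \<Longrightarrow> B u \<subseteq> K \<inter> absent_colours F d u \<and> card (B u) = card (A u)"
    "card {u \<in> U. i \<in> B u} + \<delta> = card {u \<in> U. i \<in> A u}"
    "card {u \<in> U. j \<in> B u} = card {u \<in> U. j \<in> A u} + \<delta>"
    "\<delta> \<in> {1, 2}"
    "\<And>k. k \<noteq> i \<Longrightarrow> k \<noteq> j \<Longrightarrow> {u \<in> U. k \<in> B u} = {u \<in> U. k \<in> A u}"
proof -
  define X where "X k = {u \<in> U. k \<in> A u}" for k
  have finX: "finite (X k)" for k using U by (simp add: X_def)
  obtain C :: "'a \<Rightarrow> 'a set" where
    C_refl: "\<And>x. x \<in> C x" and
    C_eq: "\<And>x y. y \<in> C x \<Longrightarrow> C y = C x" and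
    C_closed: "\<And>x e. e \<in> F \<Longrightarrow> c e \<in> {i, j} \<Longrightarrow> e \<inter> C x \<noteq> {} \<Longrightarrow> e \<subseteq> C x" and
    C_single: "\<And>x. {i, j} \<subseteq> absent_colours F c x \<Longrightarrow> C x = {x}" and
    C_ends: "\<And>x y z. y \<in> C x \<Longrightarrow> z \<in> C x \<Longrightarrow> x \<noteq> y \<Longrightarrow> x \<noteq> z \<Longrightarrow>
       {i, j} \<inter> absent_colours F c x \<noteq> {} \<Longrightarrow> {i, j} \<inter> absent_colours F c y \<noteq> {} \<Longrightarrow>
       {i, j} \<inter> absent_colours F c z \<noteq> {} \<Longrightarrow> y = z"
    by (fact kempe_chains[OF F proper, of i j])
  have end_X: "{i, j} \<inter> absent_colours F c x \<noteq> {}" if "x \<in> X i \<union> X j" for x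
    using that A by (auto simp: X_def)
  \<comment> \<open>Otherwise each vertex of \<open>X i\<close> could be sent to a vertex of
    \<open>X j\<close> on its chain. This map is injective because a chain has at most two ends,
    which contradicts the gap.\<close>
  have "\<exists>x\<in>X i. C x \<inter> X j = {}"
  proof (rule ccontr)
    assume "\<not> ?thesis"
    then have "\<forall>x\<in>X i. \<exists>y. y \<in> C x \<inter> X j" by blast
    then obtain g where g: "\<And>x. x \<in> X i \<Longrightarrow> g x \<in> C x \<inter> X j" by metis
    have "inj_on g (X i)"
    proof (rule inj_onI, rule ccontr)
      fix x y assume xy: "x \<in> X i" "y \<in> X i" "g x = g y" "x \<noteq> y"
      define z where "z = g x"
      have z: "z \<in> C x" "z \<in> C y" "z \<in> X j" using g[OF xy(1)] g[OF xy(2)] xy(3) by (auto simp: z_def)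
      have CC: "C x = C z" "C y = C z" using C_eq[OF z(1)] C_eq[OF z(2)] by simp_all
      have "z \<noteq> w" if w: "w \<in> X i" "w \<in> {x, y}" for w
      proof
        assume "z = w"
        then have "{i, j} \<subseteq> absent_colours F c z" using A w z(3) by (auto simp: X_def)
        then have "C z = {z}" by (rule C_single)
        then have "x = z" "y = z" using CC C_refl[of x] C_refl[of y] by auto
        then show False using xy by simp
      qed
      then show False
        using C_ends[of x z y] CC C_refl end_X xy z by blast
    qed
    then have "card (X i) \<le> card (X j)"
      using g finX by (intro card_inj_on_le[of g]) auto
    then show False using gap by (simp add: X_def)
  qed
  then obtain x where x: "x \<in> X i" "C x \<inter> X j = {}" by blast
  define \<tau> where "\<tau> = transpose i j"
  define d where "d e = (if e \<inter> C x \<noteq> {} then \<tau> (c e) else c e)" for e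
  define B where "B u = (if u \<in> C x then \<tau> ` A u else A u)" for u
  define \<delta> where "\<delta> = card (X i \<inter> C x)"
  have \<tau>K: "\<tau> k \<in> K \<longleftrightarrow> k \<in> K" for k using ij by (auto simp: \<tau>_def transpose_def)
  have d: "proper_edge_colouring F d"
    "\<And>u. absent_colours F d u = (if u \<in> C x then \<tau> ` absent_colours F c u else absent_colours F c u)"
  proof -
    have "d = (\<lambda>e. if e \<inter> C x \<noteq> {} then transpose i j (c e) else c e)"
      by (simp add: d_def \<tau>_def fun_eq_iff)
    then show "proper_edge_colouring F d"
      "\<And>u. absent_colours F d u = (if u \<in> C x then \<tau> ` absent_colours F c u else absent_colours F c u)"
      using kempe_swap[OF proper, of i j "C x", OF C_closed] by (simp_all add: \<tau>_def)
  qed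
  have mem_B: "k \<in> B u \<longleftrightarrow> (if u \<in> C x then \<tau> k \<in> A u else k \<in> A u)" for k u
    by (auto simp: B_def \<tau>_def image_iff) (metis transpose_involutory)
  have Bi: "{u \<in> U. i \<in> B u} = X i - C x"
    using x by (auto simp: mem_B X_def \<tau>_def)
  have Bj: "{u \<in> U. j \<in> B u} = X j \<union> (X i \<inter> C x)"
    using x by (auto simp: mem_B X_def \<tau>_def)
  \<comment> \<open>Vertices of \<open>X i\<close> on the chain are ends of it, so besides
    \<open>x\<close> there is at most one.\<close>
  have "\<exists>y. X i \<inter> C x \<subseteq> {x, y}"
  proof (cases "X i \<inter> C x \<subseteq> {x}")
    case False
    then obtain y where y: "y \<in> X i" "y \<in> C x" "y \<noteq> x" by blast
    have "z = y" if "z \<in> X i" "z \<in> C x" "z \<noteq> x" for z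
      using C_ends[OF that(2) y(2)] that y end_X x(1) by blast
    then show ?thesis by blast
  qed auto
  then obtain y where "X i \<inter> C x \<subseteq> {x, y}" by blast
  then have "\<delta> \<le> card {x, y}" unfolding \<delta>_def by (intro card_mono) auto
  then have "\<delta> \<le> 2" using card_insert_le_m1[of 2 "{y}" x] by simp
  moreover have "\<delta> > 0" unfolding \<delta>_def using x(1) C_refl finX by (auto simp: card_gt_0_iff)
  ultimately have \<delta>: "\<delta> \<in> {1, 2}" by auto
  show ?thesis
  proof (rule that[of d B \<delta>])
    show "proper_edge_colouring F d" by (fact d)
    show "d ` F \<subseteq> K" using cK by (auto simp: d_def \<tau>K)
    show "B u \<subseteq> K \<inter> absent_colours F d u \<and> card (B u) = card (A u)" if "u \<in> U" for u
    proof
      show "B u \<subseteq> K \<inter> absent_colours F d u"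
        using bspec[OF A that] \<tau>K unfolding B_def d(2) by auto
      have "inj \<tau>" unfolding \<tau>_def by (rule bij_is_inj[OF bij_transpose])
      then have "card (\<tau> ` A u) = card (A u)" using inj_on_subset by (intro card_image) blast
      then show "card (B u) = card (A u)" by (simp add: B_def)
    qed
    show "card {u \<in> U. i \<in> B u} + \<delta> = card {u \<in> U. i \<in> A u}"
      unfolding Bi \<delta>_def X_def[of i, symmetric]
      using card_Diff_subset_Int[of "X i" "C x"] finX[of i]
      by (simp add: card_mono)
    show "card {u \<in> U. j \<in> B u} = card {u \<in> U. j \<in> A u} + \<delta>"
      unfolding Bj \<delta>_def X_def[of j, symmetric]
      using x(2) finX by (intro card_Un_disjoint) auto
    show "\<delta> \<in> {1, 2}" by (fact \<delta>)
    show "{u \<in> U. k \<in> B u} = {u \<in> U. k \<in> A u}" if "k \<noteq> i" "k \<noteq> j" for k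
      using that by (auto simp: mem_B \<tau>_def)
  qed
qed

text \<open>The vertex \<open>v\<close> is joined to the vertices in \<open>U\<close>; each \<open>A u\<close> is a stock of colours
  that may be used at \<open>u\<close>. Minimising the sum of the squares of the numbers \<open>X k\<close> of vertices with
  \<open>k\<close> in stock forces some \<open>X k\<close> to be \<open>1\<close>, and the colour \<open>k\<close> can then be removed altogether.\<close>

lemma extend_edge_colouring:
  fixes F :: "'a set set" and c :: "'a set \<Rightarrow> nat" and A :: "'a \<Rightarrow> nat set"
  assumes "finite K" and "\<forall>e\<in>F. card e = 2" and "proper_edge_colouring F c" "c ` F \<subseteq> K"
    and "v \<notin> \<Union>F" and "finite U" "v \<notin> U" "card U \<le> card K" and "u0 \<in> U"
    and "\<And>u. u \<in> U \<Longrightarrow> A u \<subseteq> K \<inter> absent_colours F c u \<and> card (A u) = (if u = u0 then 1 else 2)"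
  shows "\<exists>d. proper_edge_colouring (F \<union> (\<lambda>u. {v, u}) ` U) d \<and> d ` (F \<union> (\<lambda>u. {v, u}) ` U) \<subseteq> K"
  using assms
proof (induction "card K" arbitrary: K F c U A u0 rule: less_induct)
  case less
  note finK = less.prems(1) and F = less.prems(2) and vF = less.prems(5) and finU = less.prems(6)
    and vU = less.prems(7) and card_U = less.prems(8) and u0 = less.prems(9)
  \<comment> \<open>A swap changes colouring and stocks together, so the minimum is taken over
    pairs.\<close>
  define good where "good = (\<lambda>(c :: 'a set \<Rightarrow> nat, A). proper_edge_colouring F c \<and> c ` F \<subseteq> K \<and>
    (\<forall>u\<in>U. A u \<subseteq> K \<inter> absent_colours F c u \<and> card (A u) = (if u = u0 then 1 else 2)))"
  define X where "X A k = {u \<in> U. k \<in> A u}" for A :: "'a \<Rightarrow> nat set" and k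
  define \<Phi> where "\<Phi> = (\<lambda>(c :: 'a set \<Rightarrow> nat, A). \<Sum>k\<in>K. (card (X A k))\<^sup>2)"
  have "good (c, A)" using less.prems by (simp add: good_def)
  then obtain p where p: "good p" "\<And>q. good q \<Longrightarrow> \<Phi> p \<le> \<Phi> q"
    using ex_has_least_nat[of good _ \<Phi>] by metis
  obtain c A where [simp]: "p = (c, A)" by (cases p)
  have proper: "proper_edge_colouring F c" and cK: "c ` F \<subseteq> K"
    and A: "\<forall>u\<in>U. A u \<subseteq> K \<inter> absent_colours F c u"
    and card_A: "\<And>u. u \<in> U \<Longrightarrow> card (A u) = (if u = u0 then 1 else 2)"
    using p(1) by (auto simp: good_def)
  have "(\<Sum>k\<in>K. card (X A k)) = (\<Sum>k\<in>K. \<Sum>u\<in>U. if k \<in> A u then 1 else 0)"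
    using finU by (simp add: X_def sum.If_cases Int_def)
  also have "\<dots> = (\<Sum>u\<in>U. \<Sum>k\<in>K. if k \<in> A u then 1 else 0)" by (rule sum.swap)
  also have "\<dots> = (\<Sum>u\<in>U. card (A u))"
  proof (rule sum.cong[OF refl])
    fix u assume "u \<in> U"
    then have "K \<inter> A u = A u" using A by blast
    then show "(\<Sum>k\<in>K. if k \<in> A u then 1 else 0) = card (A u)"
      using finK by (simp add: sum.If_cases)
  qed
  also have "\<dots> = (\<Sum>u\<in>U. if u = u0 then 1 else 2)" by (simp add: card_A)
  also have "\<dots> = 1 + 2 * card (U - {u0})"
    using finU u0 by (simp add: sum.remove[of U u0])
  finally have total: "(\<Sum>k\<in>K. card (X A k)) = 1 + 2 * card (U - {u0})" .
  \<comment> \<open>If the two counts differ by g, moving \<delta> vertices changes the sum of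
    squares by 2 * \<delta> * (\<delta> - g). This is negative for \<delta> \<le> 2 and g \<ge>
    3.\<close>
  have balanced: "card (X A i) < card (X A j) + 3" if ij: "i \<in> K" "j \<in> K" for i j
  proof (rule ccontr)
    assume "\<not> ?thesis"
    then have gap: "card (X A i) \<ge> card (X A j) + 3" by simp
    then have "i \<noteq> j" by auto
    obtain d B \<delta> where d: "proper_edge_colouring F d" "d ` F \<subseteq> K"
      "\<And>u. u \<in> U \<Longrightarrow> B u \<subseteq> K \<inter> absent_colours F d u \<and> card (B u) = card (A u)"
      and B': "card {u \<in> U. i \<in> B u} + \<delta> = card {u \<in> U. i \<in> A u}"
        "card {u \<in> U. j \<in> B u} = card {u \<in> U. j \<in> A u} + \<delta>"
      and \<delta>: "\<delta> \<in> {1, 2}"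
      and other: "\<And>k. k \<noteq> i \<Longrightarrow> k \<noteq> j \<Longrightarrow> {u \<in> U. k \<in> B u} = {u \<in> U. k \<in> A u}"
      by (fact kempe_balance[OF F proper cK ij finU A gap[unfolded X_def]])
    note B = B'[folded X_def]
    have "good (d, B)" using d card_A by (simp add: good_def)
    then have "\<Phi> (c, A) \<le> \<Phi> (d, B)" using p(2) by simp
    moreover have split: "\<Phi> (c', A') = (card (X A' i))\<^sup>2 + (card (X A' j))\<^sup>2 +
        (\<Sum>k\<in>K - {i} - {j}. (card (X A' k))\<^sup>2)" for c' A'
      using finK ij \<open>i \<noteq> j\<close> by (simp add: \<Phi>_def sum.remove[of K i] sum.remove[of "K - {i}" j])
    moreover have "(\<Sum>k\<in>K - {i} - {j}. (card (X A k))\<^sup>2) = (\<Sum>k\<in>K - {i} - {j}. (card (X B k))\<^sup>2)"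
      using other by (intro sum.cong) (auto simp: X_def)
    ultimately have "(card (X A i))\<^sup>2 + (card (X A j))\<^sup>2 \<le> (card (X B i))\<^sup>2 + (card (X B j))\<^sup>2"
      by simp
    moreover obtain r where "card (X A i) = card (X A j) + 3 + r" using gap le_Suc_ex by blast
    ultimately show False using B \<delta> by (auto simp: power2_eq_square algebra_simps)
  qed
  \<comment> \<open>The counts have the odd sum \<open>2 * card U - 1\<close>, which is less than
    \<open>2 * card K\<close>. Hence one count is at most 1 and one is odd; if the former is 0,
    balance forces the latter to be 1. Oddness is the reason for giving \<open>u0\<close> a single
    colour.\<close>
  obtain i where i: "i \<in> K" "card (X A i) = 1"
  proof -
    have "card (U - {u0}) < card U" using finU u0 by (intro psubset_card_mono) auto
    then have lt: "(\<Sum>k\<in>K. card (X A k)) < (\<Sum>k\<in>K. 2)" using total card_U by simp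
    have "\<exists>j\<in>K. card (X A j) < 2"
    proof (rule ccontr)
      assume "\<not> ?thesis"
      then have "(\<Sum>k\<in>K. 2) \<le> (\<Sum>k\<in>K. card (X A k))" by (intro sum_mono) (simp add: not_less)
      then show False using lt by simp
    qed
    then obtain j where j: "j \<in> K" "card (X A j) < 2" by blast
    have "odd (\<Sum>k\<in>K. card (X A k))" by (simp add: total)
    then have "\<exists>k\<in>K. odd (card (X A k))" by (meson dvd_sum)
    then obtain k where k: "k \<in> K" "odd (card (X A k))" by blast
    have "card (X A k) < card (X A j) + 3" using balanced j k by blast
    moreover have "n = 1 \<or> m = 1" if "n < m + 3" "odd n" "m < 2" for n m :: nat
      using that by presburger
    ultimately have "card (X A k) = 1 \<or> card (X A j) = 1" using k(2) j(2) by blast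
    then show thesis using that j k by blast
  qed
  then obtain u where u: "X A i = {u}" by (auto simp: card_1_singleton_iff)
  have uU: "u \<in> U" "i \<in> A u" using u by (auto simp: X_def)
  \<comment> \<open>Colour \<open>i\<close> is given to \<open>{v, u}\<close> and then withdrawn.
    The edges of this colour avoid \<open>u\<close> and \<open>v\<close>, so together with
    \<open>{v, u}\<close> they form a matching; the remaining edges are coloured from
    \<open>K - {i}\<close> by induction. No vertex of \<open>U\<close> other than \<open>u\<close>
    has \<open>i\<close> in stock.\<close>
  define F' where "F' = {e \<in> F. c e \<noteq> i}"
  define E where "E = {e \<in> F. c e = i}"
  define U' where "U' = U - {u}"
  have E: "u \<notin> e" "v \<notin> e" if "e \<in> E" for e
    using that bspec[OF A uU(1)] uU(2) vF by (auto simp: E_def absent_colours_def incident_edges_def)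
  have FE: "F \<union> (\<lambda>u. {v, u}) ` U = (F' \<union> (\<lambda>u. {v, u}) ` U') \<union> (E \<union> {{v, u}})"
    using uU by (auto simp: F'_def E_def U'_def)
  have proper': "proper_edge_colouring F' c"
    using proper by (auto simp: F'_def proper_edge_colouring_def)
  have cK': "c ` F' \<subseteq> K - {i}" using cK by (auto simp: F'_def)
  have card_K': "card (K - {i}) < card K" using finK i(1) by (intro psubset_card_mono) auto
  have stock: "A w \<subseteq> (K - {i}) \<inter> absent_colours F' c w" if "w \<in> U'" for w
  proof -
    have "i \<notin> A w" using that u by (auto simp: X_def U'_def)
    then show ?thesis using that A
      by (auto simp: U'_def F'_def absent_colours_def incident_edges_def)
  qed
  have "\<exists>d. proper_edge_colouring (F' \<union> (\<lambda>u. {v, u}) ` U') d \<and>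
    d ` (F' \<union> (\<lambda>u. {v, u}) ` U') \<subseteq> K - {i}"
  proof (cases "U' = {}")
    case True
    then show ?thesis using proper' cK' by auto
  next
    case False
    \<comment> \<open>Again exactly one vertex must stock a single colour: \<open>u0\<close> if it
      survives, otherwise an arbitrary vertex that gives up one of its two colours.\<close>
    define u1 where "u1 = (if u = u0 then SOME w. w \<in> U' else u0)"
    have u1: "u1 \<in> U'"
      using False u0 some_in_eq[of U'] by (auto simp: u1_def U'_def)
    obtain B where B: "\<And>w. w \<in> U' \<Longrightarrow> B w \<subseteq> A w \<and> card (B w) = (if w = u1 then 1 else 2)"
    proof -
      have "\<exists>S\<subseteq>A w. card S = (if w = u1 then 1 else 2)" if "w \<in> U'" for w
      proof -
        have "(if w = u1 then 1 else 2) \<le> card (A w)"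
          using that card_A[of w] by (auto simp: u1_def U'_def split: if_splits)
        then show ?thesis by (metis obtain_subset_with_card_n)
      qed
      then show ?thesis using that by metis
    qed
    have *: "\<forall>e\<in>F'. card e = 2" "v \<notin> \<Union>F'" "finite U'" "v \<notin> U'"
      using F vF finU vU by (auto simp: F'_def U'_def)
    have **: "card U' \<le> card (K - {i})"
      using finK finU i(1) uU card_U by (simp add: U'_def)
    show ?thesis
      by (rule less.hyps[OF card_K' _ *(1) proper' cK' *(2-4) ** u1, of B])
        (use finK B stock in blast)+
  qed
  then obtain d where d: "proper_edge_colouring (F' \<union> (\<lambda>u. {v, u}) ` U') d"
    "d ` (F' \<union> (\<lambda>u. {v, u}) ` U') \<subseteq> K - {i}" by blast
  define G1 where "G1 = F' \<union> (\<lambda>u. {v, u}) ` U'"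
  define G2 where "G2 = E \<union> {{v, u}}"
  define d' where "d' e = (if e \<in> G2 then i else d e)" for e
  note FE' = FE[folded G1_def G2_def] and d' = d[folded G1_def]
  have disj: "e \<inter> f = {}" if "e \<in> G2" "f \<in> G2" "e \<noteq> f" for e f
    using that E proper_edge_colouringD[OF proper, of e f] by (auto simp: E_def G2_def)
  have "proper_edge_colouring (G1 \<union> G2) d'"
    unfolding proper_edge_colouring_def
  proof (intro ballI impI)
    fix e f assume e: "e \<in> G1 \<union> G2" and f: "f \<in> G1 \<union> G2" and ef: "e \<noteq> f \<and> e \<inter> f \<noteq> {}"
    have "d e \<noteq> d f" if "e \<in> G1" "f \<in> G1"
      using that d'(1) ef unfolding proper_edge_colouring_def by blast
    moreover have "d g \<noteq> i" if "g \<in> G1" for g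
      using that d'(2) by blast
    ultimately show "d' e \<noteq> d' f"
      using disj[of e f] ef e f unfolding d'_def by (metis Un_iff)
  qed
  moreover have "d' ` (G1 \<union> G2) \<subseteq> K"
    using d'(2) i(1) by (auto simp: d'_def)
  ultimately show ?case unfolding FE' by blast
qed

theorem vizing:
  fixes E :: "'a set set"
  assumes "finite E" and E: "\<And>e. e \<in> E \<Longrightarrow> card e = 2" and deg: "\<And>x. vertex_degree E x \<le> k"
  obtains c :: "'a set \<Rightarrow> nat" where "proper_edge_colouring E c" "c ` E \<subseteq> {..k}"
proof -
  have ex: "\<exists>c. proper_edge_colouring {e \<in> E. e \<subseteq> W} c \<and> c ` {e \<in> E. e \<subseteq> W} \<subseteq> {..k}"
    if "finite W" for W
    using that
  proof (induction W)
    case empty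
    have "{e \<in> E. e \<subseteq> {}} = {}" using E by fastforce
    then show ?case by (auto simp: proper_edge_colouring_def)
  next
    case (insert v W)
    define F where "F = {e \<in> E. e \<subseteq> W}"
    define U where "U = {u \<in> W. {v, u} \<in> E}"
    obtain c where c: "proper_edge_colouring F c" "c ` F \<subseteq> {..k}"
      using insert.IH by (auto simp: F_def)
    have vU: "v \<notin> U" and vF: "v \<notin> \<Union>F" using insert by (auto simp: U_def F_def)
    have FU: "{e \<in> E. e \<subseteq> insert v W} = F \<union> (\<lambda>u. {v, u}) ` U"
    proof (intro equalityI subsetI)
      fix e assume e: "e \<in> {e \<in> E. e \<subseteq> insert v W}"
      show "e \<in> F \<union> (\<lambda>u. {v, u}) ` U"
      proof (cases "v \<in> e")
        case True
        have "card e = 2" using e E by blast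
        then obtain u where u: "e = {v, u}" "u \<noteq> v"
          using True by (auto simp: card_2_iff insert_commute)
        then show ?thesis using e by (auto simp: U_def)
      next
        case False
        then show ?thesis using e by (auto simp: F_def)
      qed
    qed (auto simp: F_def U_def)
    have finite_inc: "finite (incident_edges E x)" for x
      using \<open>finite E\<close> by (simp add: incident_edges_def)
    have "finite U" using insert by (simp add: U_def)
    have "card U = card ((\<lambda>u. {v, u}) ` U)"
      by (intro card_image[symmetric] inj_onI) (auto simp: doubleton_eq_iff)
    also have "\<dots> \<le> vertex_degree E v"
      unfolding vertex_degree_def by (intro card_mono finite_inc) (auto simp: incident_edges_def U_def)
    finally have card_U: "card U \<le> k" using deg[of v] by simp
    \<comment> \<open>The edge \<open>{v, u}\<close> is not in \<open>F\<close>, so at most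
      \<open>k - 1\<close> of the \<open>k + 1\<close> colours occur at \<open>u\<close>.\<close>
    have stock: "\<exists>S\<subseteq>{..k} \<inter> absent_colours F c u. card S = 2" if u: "u \<in> U" for u
    proof -
      have fin: "finite (incident_edges F u)" using \<open>finite E\<close> by (simp add: incident_edges_def F_def)
      have "{v, u} \<in> incident_edges E u - incident_edges F u"
        using u insert.hyps by (simp add: F_def U_def incident_edges_def)
      moreover have "incident_edges F u \<subseteq> incident_edges E u"
        by (auto simp: F_def incident_edges_def)
      ultimately have "incident_edges F u \<subset> incident_edges E u" by blast
      then have "card (incident_edges F u) < vertex_degree E u"
        unfolding vertex_degree_def using finite_inc by (intro psubset_card_mono)
      then have "card (c ` incident_edges F u) < k"
        using card_image_le[OF fin, of c] deg[of u] by linarith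
      moreover have "{..k} \<inter> absent_colours F c u = {..k} - c ` incident_edges F u"
        by (auto simp: absent_colours_def)
      ultimately have "card ({..k} \<inter> absent_colours F c u) \<ge> 2"
        using diff_card_le_card_Diff[of "c ` incident_edges F u" "{..k}"] fin by simp
      then show ?thesis by (metis obtain_subset_with_card_n)
    qed
    show ?case
    proof (cases "U = {}")
      case True
      then show ?thesis using c by (auto simp: FU)
    next
      case False
      then obtain u0 where u0: "u0 \<in> U" by blast
      have "\<exists>S\<subseteq>{..k} \<inter> absent_colours F c u. card S = (if u = u0 then 1 else 2)" if u: "u \<in> U" for u
      proof -
        obtain S where S: "S \<subseteq> {..k} \<inter> absent_colours F c u" "card S = 2" using stock[OF u] by blast
        then have "(if u = u0 then 1 else 2) \<le> card S" by simp
        then obtain T where "T \<subseteq> S" "card T = (if u = u0 then 1 else 2)"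
          by (metis obtain_subset_with_card_n)
        then show ?thesis using S by blast
      qed
      then obtain A where A: "\<And>u. u \<in> U \<Longrightarrow>
          A u \<subseteq> {..k} \<inter> absent_colours F c u \<and> card (A u) = (if u = u0 then 1 else 2)"
        by metis
      have "\<forall>e\<in>F. card e = 2" using E by (simp add: F_def)
      then show ?thesis
        unfolding FU
        using extend_edge_colouring[OF _ _ c vF \<open>finite U\<close> vU _ u0 A] card_U by simp
    qed
  qed
  have "finite (\<Union>E)" 
  proof (rule finite_Union[OF \<open>finite E\<close>])
    show "finite e" if "e \<in> E" for e using E[OF that] card_ge_0_finite[of e] by simp
  qed
  moreover have "{e \<in> E. e \<subseteq> \<Union>E} = E" by auto
  ultimately obtain c where "proper_edge_colouring E c" "c ` E \<subseteq> {..k}"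
    using ex[of "\<Union>E"] by auto
  then show ?thesis by (rule that)
qed

section \<open>The local lemma on finite products\<close>

text \<open>Exchanging the coordinates in \<open>S\<close> is an involution on pairs of outcomes. It maps
  \<open>(A \<inter> B) \<times> \<Omega>\<close> onto \<open>A \<times> B\<close> when \<open>A\<close> depends only on the coordinates in \<open>S\<close>
  and \<open>B\<close> only on the other ones.\<close>

lemma PiE_independent:
  fixes \<Omega> :: "'i \<Rightarrow> 'b set"
  assumes A: "A \<subseteq> PiE I \<Omega>" and B: "B \<subseteq> PiE I \<Omega>"
    and depA: "\<And>\<omega> \<omega>'. \<omega> \<in> A \<Longrightarrow> \<omega>' \<in> PiE I \<Omega> \<Longrightarrow> (\<And>i. i \<in> S \<Longrightarrow> \<omega> i = \<omega>' i) \<Longrightarrow> \<omega>' \<in> A"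
    and depB: "\<And>\<omega> \<omega>'. \<omega> \<in> B \<Longrightarrow> \<omega>' \<in> PiE I \<Omega> \<Longrightarrow> (\<And>i. i \<notin> S \<Longrightarrow> \<omega> i = \<omega>' i) \<Longrightarrow> \<omega>' \<in> B"
  shows "card (A \<inter> B) * card (PiE I \<Omega>) = card A * card B"
proof -
  define m where "m \<omega> \<omega>' = (\<lambda>i. if i \<in> S then \<omega> i else \<omega>' i)" for \<omega> \<omega>' :: "'i \<Rightarrow> 'b"
  define \<phi> where "\<phi> = (\<lambda>(\<omega>, \<omega>'). (m \<omega> \<omega>', m \<omega>' \<omega>))"
  have m_PiE: "m \<omega> \<omega>' \<in> PiE I \<Omega>" if "\<omega> \<in> PiE I \<Omega>" "\<omega>' \<in> PiE I \<Omega>" for \<omega> \<omega>'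
    using that by (auto simp: m_def PiE_iff extensional_def)
  have "m (m \<omega> \<omega>') (m \<omega>' \<omega>) = \<omega>" for \<omega> \<omega>'
    by (simp add: m_def fun_eq_iff)
  then have inv: "\<phi> (\<phi> p) = p" for p
    by (cases p) (simp only: \<phi>_def prod.case)
  have "bij_betw \<phi> ((A \<inter> B) \<times> PiE I \<Omega>) (A \<times> B)"
  proof (rule bij_betwI[of _ _ _ \<phi>])
    show "\<phi> \<in> (A \<inter> B) \<times> PiE I \<Omega> \<rightarrow> A \<times> B"
    proof
      fix p assume p: "p \<in> (A \<inter> B) \<times> PiE I \<Omega>"
      obtain \<omega> \<omega>' where [simp]: "p = (\<omega>, \<omega>')" by (cases p)
      have \<omega>: "\<omega> \<in> A" "\<omega> \<in> B" "\<omega> \<in> PiE I \<Omega>" "\<omega>' \<in> PiE I \<Omega>" using p A by auto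
      have "m \<omega> \<omega>' \<in> A" by (rule depA[OF \<omega>(1) m_PiE[OF \<omega>(3,4)]]) (simp add: m_def)
      moreover have "m \<omega>' \<omega> \<in> B" by (rule depB[OF \<omega>(2) m_PiE[OF \<omega>(4,3)]]) (simp add: m_def)
      ultimately show "\<phi> p \<in> A \<times> B" by (simp add: \<phi>_def)
    qed
    show "\<phi> \<in> A \<times> B \<rightarrow> (A \<inter> B) \<times> PiE I \<Omega>"
    proof
      fix p assume p: "p \<in> A \<times> B"
      obtain \<omega> \<omega>' where [simp]: "p = (\<omega>, \<omega>')" by (cases p)
      have \<omega>: "\<omega> \<in> A" "\<omega>' \<in> B" "\<omega> \<in> PiE I \<Omega>" "\<omega>' \<in> PiE I \<Omega>" using p A B by auto
      have "m \<omega> \<omega>' \<in> A" by (rule depA[OF \<omega>(1) m_PiE[OF \<omega>(3,4)]]) (simp add: m_def)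
      moreover have "m \<omega> \<omega>' \<in> B" by (rule depB[OF \<omega>(2) m_PiE[OF \<omega>(3,4)]]) (simp add: m_def)
      moreover have "m \<omega>' \<omega> \<in> PiE I \<Omega>" using \<omega> m_PiE by simp
      ultimately show "\<phi> p \<in> (A \<inter> B) \<times> PiE I \<Omega>" by (simp add: \<phi>_def)
    qed
  qed (use inv in auto)
  then have "card ((A \<inter> B) \<times> PiE I \<Omega>) = card (A \<times> B)" by (rule bij_betw_same_card)
  then show ?thesis by (simp add: card_cartesian_product)
qed

text \<open>The symmetric Lovasz local lemma for the uniform measure, with probabilities written as
  cardinalities. \<open>S j\<close> may be any set of coordinates that determines
  \<open>Bad j\<close>; disjoint coordinate sets supply the independence.\<close>

theorem local_lemma:
  fixes \<Omega> :: "'i \<Rightarrow> 'b set" and Bad :: "'j \<Rightarrow> ('i \<Rightarrow> 'b) set" and p :: real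
  assumes "finite I" and \<Omega>: "\<And>i. i \<in> I \<Longrightarrow> finite (\<Omega> i) \<and> \<Omega> i \<noteq> {}"
    and "finite J" and Bad: "\<And>j. j \<in> J \<Longrightarrow> Bad j \<subseteq> PiE I \<Omega>"
    and dep: "\<And>j \<omega> \<omega>'. j \<in> J \<Longrightarrow> \<omega> \<in> Bad j \<Longrightarrow> \<omega>' \<in> PiE I \<Omega> \<Longrightarrow>
       (\<And>i. i \<in> S j \<Longrightarrow> \<omega> i = \<omega>' i) \<Longrightarrow> \<omega>' \<in> Bad j"
    and prob: "\<And>j. j \<in> J \<Longrightarrow> real (card (Bad j)) \<le> p * card (PiE I \<Omega>)"
    and degree: "\<And>j. j \<in> J \<Longrightarrow> card {k \<in> J. S j \<inter> S k \<noteq> {}} \<le> d"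
    and "0 < d" and pd: "4 * p * d \<le> 1"
  obtains \<omega> where "\<omega> \<in> PiE I \<Omega>" "\<And>j. j \<in> J \<Longrightarrow> \<omega> \<notin> Bad j"
proof -
  let ?\<Omega> = "PiE I \<Omega>"
  have fin: "finite ?\<Omega>" using \<open>finite I\<close> \<Omega> by (intro finite_PiE) auto
  have pos: "card ?\<Omega> > 0" using fin \<Omega> by (auto simp: card_gt_0_iff PiE_eq_empty_iff)
  define good where "good T = ?\<Omega> - (\<Union>j\<in>T. Bad j)" for T
  have finG: "finite (good T)" for T using fin by (simp add: good_def)
  \<comment> \<open>Given that the events of \<open>T\<close> are avoided, \<open>Bad j\<close> has
    probability at most 1 / (2 * d). Those in \<open>T2\<close> share no coordinate with it, so
    avoiding them leaves it with probability at most p \<le> 1 / (4 * d). By induction, avoiding the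
    at most \<open>d\<close> events of \<open>T1\<close> as well retains at least half of
    \<open>good T2\<close>.\<close>
  have cond: "2 * d * real (card (Bad j \<inter> good T)) \<le> card (good T)"
    if "finite T" "T \<subseteq> J" "j \<in> J" for T j
    using that
  proof (induction "card T" arbitrary: T j rule: less_induct)
    case less
    define T1 where "T1 = {k \<in> T. S j \<inter> S k \<noteq> {}}"
    define T2 where "T2 = T - T1"
    have T12: "T = T1 \<union> T2" "finite T1" "finite T2" "T1 \<subseteq> J" "T2 \<subseteq> J"
      using less.prems by (auto simp: T1_def T2_def)
    have "card T1 \<le> card {k \<in> J. S j \<inter> S k \<noteq> {}}"
      using \<open>finite J\<close> less.prems by (intro card_mono) (auto simp: T1_def)
    then have card_T1: "card T1 \<le> d" using degree[OF less.prems(3)] by simp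
    have "card (Bad j \<inter> good T2) * card ?\<Omega> = card (Bad j) * card (good T2)"
    proof (rule PiE_independent[of _ _ _ _ "S j"])
      show "Bad j \<subseteq> ?\<Omega>" using Bad less.prems by simp
      show "good T2 \<subseteq> ?\<Omega>" by (auto simp: good_def)
      show "\<omega>' \<in> Bad j" if "\<omega> \<in> Bad j" "\<omega>' \<in> ?\<Omega>" "\<And>i. i \<in> S j \<Longrightarrow> \<omega> i = \<omega>' i" for \<omega> \<omega>'
        using dep[of j \<omega> \<omega>'] that less.prems by blast
      show "\<omega>' \<in> good T2" if \<omega>: "\<omega> \<in> good T2" "\<omega>' \<in> ?\<Omega>" "\<And>i. i \<notin> S j \<Longrightarrow> \<omega> i = \<omega>' i" for \<omega> \<omega>'
      proof -
        have "\<omega>' \<notin> Bad k" if k: "k \<in> T2" for k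
        proof
          assume bad: "\<omega>' \<in> Bad k"
          have kJ: "k \<in> J" using k T12(5) by blast
          have "S j \<inter> S k = {}" using k by (auto simp: T1_def T2_def)
          then have "\<omega>' i = \<omega> i" if "i \<in> S k" for i
            using \<omega>(3)[of i] that by (metis IntI empty_iff)
          moreover have "\<omega> \<in> ?\<Omega>" using \<omega>(1) by (simp add: good_def)
          ultimately have "\<omega> \<in> Bad k" using dep[OF kJ bad] by blast
          then show False using \<omega>(1) k by (auto simp: good_def)
        qed
        then show ?thesis using \<omega>(2) by (auto simp: good_def)
      qed
    qed
    then have "real (card (Bad j \<inter> good T2)) * card ?\<Omega> = real (card (Bad j)) * card (good T2)"
      by (metis of_nat_mult)
    also have "\<dots> \<le> (p * card ?\<Omega>) * card (good T2)"
      using prob[OF less.prems(3)] by (intro mult_right_mono) auto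
    finally have "real (card (Bad j \<inter> good T2)) \<le> p * card (good T2)"
      using pos by (simp add: mult_ac)
    then have "4 * d * real (card (Bad j \<inter> good T2)) \<le> (4 * p * d) * card (good T2)"
      using mult_left_mono[of "real (card (Bad j \<inter> good T2))" "p * card (good T2)" "4 * real d"]
      by (simp add: mult_ac)
    also have "\<dots> \<le> 1 * real (card (good T2))" using pd by (intro mult_right_mono) auto
    finally have upper: "4 * d * real (card (Bad j \<inter> good T2)) \<le> card (good T2)" by simp
    have "real (card (good T2)) \<le> 2 * card (good T)"
    proof (cases "T1 = {}")
      case True
      then show ?thesis using T12 by simp
    next
      case False
      then have "T2 \<subset> T" by (auto simp: T2_def T1_def)
      then have less_T: "card T2 < card T" using less.prems(1) by (intro psubset_card_mono)
      have IH: "2 * d * real (card (Bad k \<inter> good T2)) \<le> card (good T2)" if "k \<in> T1" for k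
        by (rule less.hyps[OF less_T T12(3,5)]) (use that T12(4) in blast)
      have "good T2 \<subseteq> good T \<union> (\<Union>k\<in>T1. Bad k \<inter> good T2)"
        using T12 by (auto simp: good_def)
      then have "card (good T2) \<le> card (good T \<union> (\<Union>k\<in>T1. Bad k \<inter> good T2))"
        using finG T12 by (intro card_mono) auto
      also have "\<dots> \<le> card (good T) + card (\<Union>k\<in>T1. Bad k \<inter> good T2)" by (rule card_Un_le)
      also have "\<dots> \<le> card (good T) + (\<Sum>k\<in>T1. card (Bad k \<inter> good T2))"
        using T12 by (intro add_left_mono card_UN_le)
      finally have "2 * d * real (card (good T2)) \<le>
          2 * d * real (card (good T) + (\<Sum>k\<in>T1. card (Bad k \<inter> good T2)))"
        by (intro mult_left_mono) (auto simp only: of_nat_le_iff)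
      also have "\<dots> = 2 * d * real (card (good T)) + (\<Sum>k\<in>T1. 2 * d * real (card (Bad k \<inter> good T2)))"
        by (simp add: distrib_left sum_distrib_left)
      also have "(\<Sum>k\<in>T1. 2 * d * real (card (Bad k \<inter> good T2))) \<le> (\<Sum>k\<in>T1. real (card (good T2)))"
        by (intro sum_mono IH)
      also have "\<dots> \<le> d * real (card (good T2))" using card_T1 by (simp add: mult_right_mono)
      finally have "d * real (card (good T2)) \<le> d * (2 * real (card (good T)))" by simp
      then show ?thesis using \<open>0 < d\<close> by simp
    qed
    moreover have "real (card (Bad j \<inter> good T)) \<le> card (Bad j \<inter> good T2)"
      using finG T12 by (auto intro!: card_mono simp: good_def)
    then have "4 * d * real (card (Bad j \<inter> good T)) \<le> 4 * d * real (card (Bad j \<inter> good T2))"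
      by (intro mult_left_mono) auto
    ultimately show ?case using upper by simp
  qed
  have "card (good T) > 0" if "finite T" "T \<subseteq> J" for T
    using that
  proof (induction T)
    case empty
    then show ?case using pos by (simp add: good_def)
  next
    case (insert j T)
    have "real d * real (card (Bad j \<inter> good T)) < real d * real (card (good T))"
    proof -
      have "2 * (d * real (card (Bad j \<inter> good T))) \<le> 1 * real (card (good T))"
        using cond[of T j] insert.prems insert.hyps by simp
      also have "1 * real (card (good T)) \<le> real d * real (card (good T))"
        using \<open>0 < d\<close> by (intro mult_right_mono) auto
      finally have "2 * (d * real (card (Bad j \<inter> good T))) \<le> real d * real (card (good T))" .
      moreover have "d * real (card (good T)) > 0" using insert \<open>0 < d\<close> by simp
      ultimately show ?thesis by linarith
    qed
    then have "card (Bad j \<inter> good T) < card (good T)" using \<open>0 < d\<close> by simp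
    then have "good T - Bad j \<noteq> {}" by (metis Diff_eq_empty_iff inf.absorb2 less_irrefl)
    moreover have "good (insert j T) = good T - Bad j" by (auto simp: good_def)
    ultimately show ?case using finG by (simp add: card_gt_0_iff)
  qed
  then have "good J \<noteq> {}" using \<open>finite J\<close> by (metis card.empty less_irrefl order_refl)
  then show ?thesis using that by (auto simp: good_def)
qed

section \<open>Random picks\<close>

text \<open>Conditioning on the coordinates outside \<open>S\<close>: if at most \<open>M\<close>
  settings of those in \<open>S\<close> lead to \<open>B\<close>, whatever the others are, then
  \<open>B\<close> has probability at most \<open>M\<close> divided by the number of
  settings.\<close>

lemma PiE_fibre_bound:
  fixes \<Omega> :: "'i \<Rightarrow> 'b set"
  assumes I: "finite I" and \<Omega>: "\<And>i. i \<in> I \<Longrightarrow> finite (\<Omega> i)" and S: "S \<subseteq> I" and B: "B \<subseteq> PiE I \<Omega>"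
    and fibre: "\<And>\<omega>. \<omega> \<in> B \<Longrightarrow> card {\<omega>' \<in> B. \<forall>i\<in>I - S. \<omega>' i = \<omega> i} \<le> M"
  shows "card B * (\<Prod>i\<in>S. card (\<Omega> i)) \<le> M * card (PiE I \<Omega>)"
proof -
  define r where "r \<omega> = restrict \<omega> (I - S)" for \<omega> :: "'i \<Rightarrow> 'b"
  have "finite (PiE I \<Omega>)" using I \<Omega> by (intro finite_PiE)
  then have finB: "finite B" using B by (rule rev_finite_subset)
  have "card B = card (\<Union>\<rho>\<in>r ` B. {\<omega>' \<in> B. r \<omega>' = \<rho>})" by (rule arg_cong[of _ _ card]) auto
  also have "\<dots> \<le> (\<Sum>\<rho>\<in>r ` B. card {\<omega>' \<in> B. r \<omega>' = \<rho>})" using finB by (intro card_UN_le) simp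
  also have "\<dots> \<le> (\<Sum>\<rho>\<in>r ` B. M)"
  proof (rule sum_mono)
    fix \<rho> assume "\<rho> \<in> r ` B"
    then obtain \<omega> where \<omega>: "\<omega> \<in> B" "\<rho> = r \<omega>" by blast
    have "r \<omega>' = r \<omega> \<longleftrightarrow> (\<forall>i\<in>I - S. \<omega>' i = \<omega> i)" for \<omega>'
      unfolding r_def fun_eq_iff restrict_def by (meson DiffD1)
    then show "card {\<omega>' \<in> B. r \<omega>' = \<rho>} \<le> M" using fibre[OF \<omega>(1)] \<omega>(2) by simp
  qed
  also have "\<dots> \<le> card (PiE (I - S) \<Omega>) * M"
  proof -
    have "r \<omega> \<in> PiE (I - S) \<Omega>" if "\<omega> \<in> B" for \<omega>
      using subsetD[OF B that] by (simp add: r_def PiE_iff)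
    then have "r ` B \<subseteq> PiE (I - S) \<Omega>" by blast
    then have "card (r ` B) \<le> card (PiE (I - S) \<Omega>)" using I \<Omega> by (intro card_mono finite_PiE) auto
    then show ?thesis by simp
  qed
  finally have "card B * (\<Prod>i\<in>S. card (\<Omega> i)) \<le> (card (PiE (I - S) \<Omega>) * M) * (\<Prod>i\<in>S. card (\<Omega> i))"
    by (rule mult_right_mono) simp
  also have "\<dots> = M * card (PiE I \<Omega>)"
    using I S by (simp add: card_PiE prod.subset_diff[of S I] mult_ac)
  finally show ?thesis .
qed

lemma edge_eqI:
  assumes "card e = 2" "u \<in> e" "v \<in> e" "u \<noteq> v"
  shows "e = {u, v}"
  using assms by (auto simp: card_2_iff)

text \<open>Vertex \<open>x\<close> picks the edges \<open>\<omega> (x, 0), \<dots>, \<omega> (x, h - 1)\<close>.\<close>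

locale random_picks =
  fixes V :: "'a set" and E :: "'a set set" and c :: "'a set \<Rightarrow> nat" and h q m \<Delta> :: nat
  assumes graph: "simple_graph V E" and proper: "proper_edge_colouring E c"
    and deg: "\<And>x. x \<in> V \<Longrightarrow> m \<le> vertex_degree E x \<and> vertex_degree E x \<le> \<Delta>" and m: "0 < m"
begin

definition I :: "('a \<times> nat) set" where "I = V \<times> {..<h}"

definition \<Omega> :: "('a \<times> nat \<Rightarrow> 'a set) set" where "\<Omega> = PiE I (\<lambda>p. incident_edges E (fst p))"

text \<open>Slots are counted rather than edges. An edge picked twice counts twice, which can only
  overestimate the degree and allows a union bound over sets of coordinates.\<close>

definition in_picks :: "('a \<times> nat \<Rightarrow> 'a set) \<Rightarrow> 'a \<Rightarrow> ('a \<times> nat) set" where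
  "in_picks \<omega> u = {p \<in> I. fst p \<noteq> u \<and> u \<in> \<omega> p}"

definition palette :: "('a \<times> nat \<Rightarrow> 'a set) \<Rightarrow> 'a \<Rightarrow> nat set" where
  "palette \<omega> u = c ` incident_edges (E - \<omega> ` I) u"

definition nbhd :: "'a \<Rightarrow> 'a set" where "nbhd u = {v. {u, v} \<in> E}"

definition crowded :: "'a \<Rightarrow> ('a \<times> nat \<Rightarrow> 'a set) set" where
  "crowded u = {\<omega> \<in> \<Omega>. q \<le> card (in_picks \<omega> u)}"

text \<open>Crowding at \<open>u\<close> is excluded because only then are the picks of
  \<open>u\<close> confined to a small set. It is charged to \<open>crowded u\<close> once, not once
  per neighbour.\<close>

definition conflict :: "'a \<Rightarrow> 'a \<Rightarrow> ('a \<times> nat \<Rightarrow> 'a set) set" where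
  "conflict u v = {\<omega> \<in> \<Omega>. card (in_picks \<omega> u) < q \<and> palette \<omega> u = palette \<omega> v}"

text \<open>One event per vertex keeps the number of dependent events at the number of vertices
  within distance 4; the cost is a factor \<Delta> in \<open>prob_bound\<close>.\<close>

definition Bad :: "'a \<Rightarrow> ('a \<times> nat \<Rightarrow> 'a set) set" where
  "Bad u = crowded u \<union> (\<Union>v\<in>nbhd u. conflict u v)"

lemma finite_V: "finite V" and edge_subset: "e \<in> E \<Longrightarrow> e \<subseteq> V" and edge_card: "e \<in> E \<Longrightarrow> card e = 2"
  using graph by (auto simp: simple_graph_def)

lemma finite_E: "finite E"
  using finite_V edge_subset by (intro finite_subset[of E "Pow V"]) auto

lemma finite_incident: "finite (incident_edges E x)"
  using finite_E by (simp add: incident_edges_def)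

lemma finite_I: "finite I"
  using finite_V by (simp add: I_def)

lemma finite_\<Omega>: "finite \<Omega>"
  unfolding \<Omega>_def using finite_I finite_incident by (intro finite_PiE)

lemma pick: 
  assumes "\<omega> \<in> \<Omega>" "p \<in> I"
  shows "\<omega> p \<in> E" "fst p \<in> \<omega> p"
  using assms by (auto simp: \<Omega>_def incident_edges_def)

lemma nbhd_subset: "nbhd u \<subseteq> V" and nbhd_neq: "v \<in> nbhd u \<Longrightarrow> v \<noteq> u"
  and nbhd_sym: "v \<in> nbhd u \<longleftrightarrow> u \<in> nbhd v"
  using edge_subset edge_card[of "{u, v}"] by (auto simp: nbhd_def insert_commute)

lemma card_nbhd:
  assumes "u \<in> V"
  shows "card (nbhd u) \<le> \<Delta>"
proof -
  have "card (nbhd u) = card ((\<lambda>v. {u, v}) ` nbhd u)"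
    by (intro card_image[symmetric] inj_onI) (auto simp: doubleton_eq_iff)
  also have "\<dots> \<le> vertex_degree E u"
    unfolding vertex_degree_def
    by (intro card_mono finite_incident) (auto simp: nbhd_def incident_edges_def)
  finally show ?thesis using deg[OF assms] by simp
qed

lemma pick_nbhd:
  assumes "\<omega> \<in> \<Omega>" "p \<in> I" "y \<in> \<omega> p" "fst p \<noteq> y"
  shows "fst p \<in> nbhd y" "\<omega> p = {fst p, y}"
proof -
  show "\<omega> p = {fst p, y}"
    using edge_eqI[OF edge_card[OF pick(1)[OF assms(1,2)]] pick(2)[OF assms(1,2)] assms(3,4)] .
  then show "fst p \<in> nbhd y" using pick(1)[OF assms(1,2)] by (simp add: nbhd_def insert_commute)
qed

section \<open>Probabilities of the bad events\<close>

text \<open>A union bound over the \<open>q\<close>-element sets of slots at neighbours of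
  \<open>u\<close>, each slot hitting \<open>u\<close> with probability at most 1 / m. The factor
  \<open>fact q\<close> is what later beats every power of \<Delta>.\<close>

lemma card_crowded:
  assumes u: "u \<in> V"
  shows "card (crowded u) * (m ^ q * fact q) \<le> (h * \<Delta>) ^ q * card \<Omega>"
proof -
  define P where "P = nbhd u \<times> {..<h}"
  define Ws where "Ws = {W. W \<subseteq> P \<and> card W = q}"
  define fixing where "fixing W = {\<omega> \<in> \<Omega>. \<forall>p\<in>W. \<omega> p = {fst p, u}}" for W
  have finP: "finite P" using finite_subset[OF nbhd_subset finite_V] by (simp add: P_def)
  have PI: "P \<subseteq> I" using nbhd_subset by (auto simp: P_def I_def)
  have finWs: "finite Ws" using finP by (simp add: Ws_def)
  have "crowded u \<subseteq> (\<Union>W\<in>Ws. fixing W)"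
  proof
    fix \<omega> assume "\<omega> \<in> crowded u"
    then have \<omega>: "\<omega> \<in> \<Omega>" "q \<le> card (in_picks \<omega> u)" by (auto simp: crowded_def)
    obtain W where W: "W \<subseteq> in_picks \<omega> u" "card W = q" using \<omega>(2) by (metis obtain_subset_with_card_n)
    have "in_picks \<omega> u \<subseteq> P"
      using pick_nbhd[OF \<omega>(1)] by (auto simp: in_picks_def P_def I_def)
    then have "W \<in> Ws" using W by (auto simp: Ws_def)
    moreover have "\<omega> \<in> fixing W"
      using W \<omega>(1) pick_nbhd(2)[OF \<omega>(1)] unfolding fixing_def in_picks_def by blast
    ultimately show "\<omega> \<in> (\<Union>W\<in>Ws. fixing W)" by blast
  qed
  then have "card (crowded u) \<le> card (\<Union>W\<in>Ws. fixing W)"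
    using finWs finite_\<Omega> by (intro card_mono) (auto simp: fixing_def)
  also have "\<dots> \<le> (\<Sum>W\<in>Ws. card (fixing W))" using finWs by (rule card_UN_le)
  finally have "card (crowded u) * m ^ q \<le> (\<Sum>W\<in>Ws. card (fixing W) * m ^ q)"
    by (simp add: sum_distrib_right[symmetric])
  also have "\<dots> \<le> (\<Sum>W\<in>Ws. card \<Omega>)"
  proof (rule sum_mono)
    fix W assume "W \<in> Ws"
    then have W: "W \<subseteq> I" "card W = q" using PI by (auto simp: Ws_def)
    have "m ^ q = (\<Prod>p\<in>W. m)" by (simp add: W)
    also have "\<dots> \<le> (\<Prod>p\<in>W. card (incident_edges E (fst p)))"
      using W deg by (intro prod_mono) (auto simp: I_def vertex_degree_def)
    finally have "card (fixing W) * m ^ q \<le> card (fixing W) * (\<Prod>p\<in>W. card (incident_edges E (fst p)))"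
      by simp
    also have "\<dots> \<le> 1 * card \<Omega>"
      unfolding \<Omega>_def
    proof (rule PiE_fibre_bound[OF finite_I finite_incident W(1)])
      show "fixing W \<subseteq> PiE I (\<lambda>p. incident_edges E (fst p))" by (auto simp: fixing_def \<Omega>_def)
      show "card {\<omega>' \<in> fixing W. \<forall>i\<in>I - W. \<omega>' i = \<omega> i} \<le> 1" if "\<omega> \<in> fixing W" for \<omega>
      proof -
        have "\<omega>' = \<omega>" if "\<omega>' \<in> fixing W" "\<forall>i\<in>I - W. \<omega>' i = \<omega> i" for \<omega>'
        proof (rule PiE_ext)
          show "\<omega>' \<in> PiE I (\<lambda>p. incident_edges E (fst p))" "\<omega> \<in> PiE I (\<lambda>p. incident_edges E (fst p))"
            using that \<open>\<omega> \<in> fixing W\<close> by (auto simp: fixing_def \<Omega>_def)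
          show "\<omega>' p = \<omega> p" if "p \<in> I" for p
            using that \<open>\<omega>' \<in> fixing W\<close> \<open>\<omega> \<in> fixing W\<close> \<open>\<forall>i\<in>I - W. \<omega>' i = \<omega> i\<close>
            by (cases "p \<in> W") (simp_all add: fixing_def)
        qed
        then have "{\<omega>' \<in> fixing W. \<forall>i\<in>I - W. \<omega>' i = \<omega> i} \<subseteq> {\<omega>}" by blast
        then show ?thesis using card_mono[of "{\<omega>}"] by fastforce
      qed
    qed
    finally show "card (fixing W) * m ^ q \<le> card \<Omega>" by simp
  qed
  also have "\<dots> = (card P choose q) * card \<Omega>"
    using n_subsets[OF finP, of q] by (simp add: Ws_def)
  finally have "card (crowded u) * m ^ q * fact q \<le> (card P choose q) * card \<Omega> * fact q"
    by (rule mult_right_mono) simp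
  also have "\<dots> = ((card P choose q) * fact q) * card \<Omega>" by simp
  also have "\<dots> \<le> card P ^ q * card \<Omega>"
    by (intro mult_right_mono binomial_fact_pow) simp
  also have "\<dots> \<le> (h * \<Delta>) ^ q * card \<Omega>"
    using card_nbhd[OF u] by (intro mult_right_mono power_mono) (auto simp: P_def card_cartesian_product)
  finally show ?thesis by (simp add: mult_ac)
qed

lemma degree_picks:
  assumes \<omega>: "\<omega> \<in> \<Omega>"
  shows "vertex_degree (\<omega> ` I) u \<le> h + card (in_picks \<omega> u)"
proof -
  have fin: "finite (in_picks \<omega> u)" using finite_I by (simp add: in_picks_def)
  have "incident_edges (\<omega> ` I) u \<subseteq> \<omega> ` ({u} \<times> {..<h} \<union> in_picks \<omega> u)"
    by (auto simp: incident_edges_def in_picks_def I_def)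
  then have "vertex_degree (\<omega> ` I) u \<le> card (\<omega> ` ({u} \<times> {..<h} \<union> in_picks \<omega> u))"
    unfolding vertex_degree_def using fin by (intro card_mono) auto
  also have "\<dots> \<le> card ({u} \<times> {..<h} \<union> in_picks \<omega> u)" using fin by (intro card_image_le) auto
  also have "\<dots> \<le> card ({u} \<times> {..<h}) + card (in_picks \<omega> u)" by (rule card_Un_le)
  finally show ?thesis by simp
qed

text \<open>Once the picks of the vertices other than \<open>u\<close> are given, equality of the two palettes confines
  the picks of \<open>u\<close> to a set \<open>R\<close> that consists of \<open>uv\<close> and fewer than \<open>h + q\<close> other edges.\<close>

lemma card_conflict:
  assumes u: "u \<in> V" and uv: "v \<in> nbhd u"
  shows "card (conflict u v) * m ^ h \<le> (h + q) ^ h * card \<Omega>"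
proof -
  define S where "S = {u} \<times> {..<h}"
  define e where "e = {u, v}"
  have SI: "S \<subseteq> I" using u by (auto simp: S_def I_def)
  have e: "e \<in> E" "u \<in> e" "v \<in> e" "u \<noteq> v" using uv nbhd_neq[OF uv] by (auto simp: nbhd_def e_def)
  have only_e: "f = e" if "f \<in> E" "u \<in> f" "v \<in> f" for f
    using edge_eqI[OF edge_card[OF that(1)] that(2,3) e(4)] by (simp add: e_def)
  have c_eq: "f = g" if "f \<in> E" "g \<in> E" "u \<in> f" "u \<in> g" "c f = c g" for f g
    using proper_edge_colouringD[OF proper that] .
  have "m ^ h = (\<Prod>p\<in>S. m)" by (simp add: S_def)
  also have "\<dots> \<le> (\<Prod>p\<in>S. card (incident_edges E (fst p)))"
    using deg[OF u] by (intro prod_mono) (auto simp: S_def vertex_degree_def)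
  finally have "card (conflict u v) * m ^ h \<le> card (conflict u v) * (\<Prod>p\<in>S. card (incident_edges E (fst p)))"
    by simp
  also have "\<dots> \<le> (h + q) ^ h * card \<Omega>"
    unfolding \<Omega>_def
  proof (rule PiE_fibre_bound[OF finite_I finite_incident SI])
    show "conflict u v \<subseteq> PiE I (\<lambda>p. incident_edges E (fst p))" by (auto simp: conflict_def \<Omega>_def)
    fix \<omega> assume "\<omega> \<in> conflict u v"
    then have \<omega>: "\<omega> \<in> \<Omega>" "card (in_picks \<omega> u) < q" "palette \<omega> u = palette \<omega> v"
      by (auto simp: conflict_def)
    \<comment> \<open>Old colours that \<open>v\<close> keeps on edges other than \<open>uv\<close>.
      The picks of \<open>u\<close> cannot affect them, since \<open>uv\<close> is the only edge at
      \<open>v\<close> that \<open>u\<close> can pick.\<close>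
    define T where "T \<omega> = c ` (incident_edges (E - \<omega> ` I) v - {e})" for \<omega>
    define R where "R = {f \<in> incident_edges E u. f = e \<or> c f \<notin> T \<omega>}"
    \<comment> \<open>An unpicked edge at \<open>u\<close> other than \<open>e\<close> has its
      colour in both palettes, hence in \<open>T \<omega>\<close>.\<close>
    have "R \<subseteq> insert e (incident_edges (\<omega> ` I) u)"
    proof
      fix f assume f: "f \<in> R"
      show "f \<in> insert e (incident_edges (\<omega> ` I) u)"
      proof (rule ccontr)
        assume neg: "f \<notin> insert e (incident_edges (\<omega> ` I) u)"
        then have "c f \<in> palette \<omega> u" using f by (auto simp: palette_def R_def incident_edges_def)
        then obtain g where g: "g \<in> incident_edges (E - \<omega> ` I) v" "c f = c g"
          using \<omega>(3) by (auto simp: palette_def)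
        have "g \<noteq> e" using c_eq[of f e] g neg f e by (auto simp: R_def incident_edges_def)
        then have "c f \<in> T \<omega>" using g by (auto simp: T_def)
        then show False using f neg by (auto simp: R_def)
      qed
    qed
    moreover have fin: "finite (incident_edges (\<omega> ` I) u)" using finite_I by (simp add: incident_edges_def)
    ultimately have "card R \<le> card (insert e (incident_edges (\<omega> ` I) u))" by (intro card_mono) auto
    also have "\<dots> \<le> Suc (vertex_degree (\<omega> ` I) u)"
      unfolding vertex_degree_def by (rule card_insert_le_m1[of "Suc _", simplified]) simp_all
    \<comment> \<open>The strict inequality \<open>card (in_picks \<omega> u) < q\<close> makes room
      for the edge \<open>e\<close>.\<close>
    also have "\<dots> \<le> h + q" using degree_picks[OF \<omega>(1), of u] \<omega>(2) by simp
    finally have card_R: "card R \<le> h + q" .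
    have finR: "finite R" using finite_incident by (simp add: R_def)
    have "{\<omega>' \<in> conflict u v. \<forall>i\<in>I - S. \<omega>' i = \<omega> i} \<subseteq> PiE I (\<lambda>p. if p \<in> S then R else {\<omega> p})"
    proof
      fix \<omega>' assume "\<omega>' \<in> {\<omega>' \<in> conflict u v. \<forall>i\<in>I - S. \<omega>' i = \<omega> i}"
      then have \<omega>': "\<omega>' \<in> \<Omega>" "palette \<omega>' u = palette \<omega>' v" and eq: "\<And>i. i \<in> I - S \<Longrightarrow> \<omega>' i = \<omega> i"
        by (auto simp: conflict_def)
      have "g \<in> \<omega> ` I \<longleftrightarrow> g \<in> \<omega>' ` I" if g: "g \<in> E" "v \<in> g" "g \<noteq> e" for g
      proof -
        have "g \<in> \<psi> ` I" if \<chi>: "g \<in> \<chi> ` I" "\<chi> \<in> \<Omega>" "\<forall>i\<in>I - S. \<chi> i = \<psi> i" for \<chi> \<psi>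
        proof -
          obtain p where p: "p \<in> I" "g = \<chi> p" using \<chi>(1) by blast
          have "p \<notin> S"
            using pick(2)[OF \<chi>(2) p(1)] only_e[OF g(1) _ g(2)] g(3) p(2) by (auto simp: S_def)
          then have "g = \<psi> p" using p \<chi>(3) by simp
          then show ?thesis using p(1) by blast
        qed
        from this[of \<omega> \<omega>'] this[of \<omega>' \<omega>] show ?thesis using \<omega>(1) \<omega>'(1) eq by auto
      qed
      then have "incident_edges (E - \<omega> ` I) v - {e} = incident_edges (E - \<omega>' ` I) v - {e}"
        by (auto simp: incident_edges_def)
      then have T_eq: "T \<omega> = T \<omega>'" by (simp add: T_def)
      \<comment> \<open>A pick with colour in \<open>T\<close> would remove from the palette of
        \<open>u\<close> a colour that \<open>v\<close> still has.\<close>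
      have "\<omega>' p \<in> R" if p: "p \<in> S" for p
      proof -
        have pI: "p \<in> I" "fst p = u" using p SI by (auto simp: S_def)
        have f: "\<omega>' p \<in> E" "u \<in> \<omega>' p" using pick[OF \<omega>'(1) pI(1)] pI(2) by auto
        have "c (\<omega>' p) \<notin> T \<omega>'"
        proof
          assume "c (\<omega>' p) \<in> T \<omega>'"
          then have "c (\<omega>' p) \<in> palette \<omega>' u" using \<omega>'(2) by (auto simp: T_def palette_def)
          then obtain g where g: "g \<in> E" "g \<notin> \<omega>' ` I" "u \<in> g" "c (\<omega>' p) = c g"
            by (auto simp: palette_def incident_edges_def)
          then have "\<omega>' p = g" using c_eq f by blast
          then show False using g(2) pI(1) by blast
        qed
        then show ?thesis using f by (simp add: R_def T_eq incident_edges_def)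
      qed
      then show "\<omega>' \<in> PiE I (\<lambda>p. if p \<in> S then R else {\<omega> p})"
        using \<omega>'(1) eq by (auto simp: \<Omega>_def PiE_iff)
    qed
    then have "card {\<omega>' \<in> conflict u v. \<forall>i\<in>I - S. \<omega>' i = \<omega> i} \<le>
        card (PiE I (\<lambda>p. if p \<in> S then R else {\<omega> p}))"
      using finite_I finR by (intro card_mono finite_PiE) auto
    also have "\<dots> = (\<Prod>p\<in>I. if p \<in> S then card R else 1)"
      using finite_I by (simp add: card_PiE if_distrib[of card] cong: if_cong)
    also have "\<dots> = card R ^ card S"
      using finite_I SI by (simp add: prod.If_cases Int_absorb1)
    also have "\<dots> \<le> (h + q) ^ h"
      using card_R by (simp add: S_def power_mono)
    finally show "card {\<omega>' \<in> conflict u v. \<forall>i\<in>I - S. \<omega>' i = \<omega> i} \<le> (h + q) ^ h" .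
  qed
  finally show ?thesis .
qed

definition prob_bound :: real where
  "prob_bound = real (h * \<Delta>) ^ q / (real m ^ q * fact q) + real \<Delta> * (real (h + q) / real m) ^ h"

lemma card_Bad:
  assumes u: "u \<in> V"
  shows "real (card (Bad u)) \<le> prob_bound * card \<Omega>"
proof -
  have fin: "finite (nbhd u)" using finite_V nbhd_subset by (rule rev_finite_subset)
  have "card (Bad u) \<le> card (crowded u) + card (\<Union>v\<in>nbhd u. conflict u v)"
    unfolding Bad_def by (rule card_Un_le)
  also have "\<dots> \<le> card (crowded u) + (\<Sum>v\<in>nbhd u. card (conflict u v))"
    by (intro add_left_mono card_UN_le fin)
  finally have "real (card (Bad u)) \<le> real (card (crowded u)) + (\<Sum>v\<in>nbhd u. real (card (conflict u v)))"
    by (metis of_nat_add of_nat_le_iff of_nat_sum)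
  also have "real (card (crowded u)) \<le> real (h * \<Delta>) ^ q / (real m ^ q * fact q) * card \<Omega>"
  proof -
    have "real (card (crowded u) * (m ^ q * fact q)) \<le> real ((h * \<Delta>) ^ q * card \<Omega>)"
      using card_crowded[OF u] by (simp only: of_nat_le_iff)
    then show ?thesis using m by (simp add: field_simps)
  qed
  also have "(\<Sum>v\<in>nbhd u. real (card (conflict u v))) \<le> (\<Sum>v\<in>nbhd u. (real (h + q) / real m) ^ h * card \<Omega>)"
  proof (rule sum_mono)
    fix v assume v: "v \<in> nbhd u"
    have "real (card (conflict u v) * m ^ h) \<le> real ((h + q) ^ h * card \<Omega>)"
      using card_conflict[OF u v] by (simp only: of_nat_le_iff)
    then show "real (card (conflict u v)) \<le> (real (h + q) / real m) ^ h * card \<Omega>"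
      using m by (simp add: field_simps)
  qed
  also have "\<dots> \<le> real \<Delta> * ((real (h + q) / real m) ^ h * card \<Omega>)"
    using card_nbhd[OF u] by (simp add: mult_right_mono)
  finally show ?thesis by (simp add: prob_bound_def algebra_simps)
qed

section \<open>Locality of the bad events\<close>

definition ball1 :: "'a \<Rightarrow> 'a set" where "ball1 u = insert u (nbhd u)"

text \<open>Radius 2 is needed because a conflict involves edges at a neighbour of \<open>u\<close>,
  and these may be picked by their far ends.\<close>

definition ball2 :: "'a \<Rightarrow> 'a set" where "ball2 u = (\<Union>x\<in>ball1 u. ball1 x)"

lemma ball1_subset: "u \<in> V \<Longrightarrow> ball1 u \<subseteq> V"
  using nbhd_subset by (auto simp: ball1_def)

lemma ball2_subset: "u \<in> V \<Longrightarrow> ball2 u \<subseteq> V"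
  using ball1_subset by (auto simp: ball2_def)

lemma ball2_sym: "x \<in> ball2 u \<longleftrightarrow> u \<in> ball2 x"
  using nbhd_sym by (auto simp: ball2_def ball1_def)

lemma card_ball1:
  assumes "u \<in> V"
  shows "card (ball1 u) \<le> \<Delta> + 1"
  using card_nbhd[OF assms] card_insert_le_m1[of "\<Delta> + 1" "nbhd u" u] by (simp add: ball1_def)

lemma card_UN_bounded:
  assumes "finite A" "\<And>x. x \<in> A \<Longrightarrow> card (B x) \<le> k" "card A \<le> l"
  shows "card (\<Union>x\<in>A. B x) \<le> l * k"
proof -
  have "card (\<Union>x\<in>A. B x) \<le> (\<Sum>x\<in>A. card (B x))" using assms(1) by (rule card_UN_le)
  also have "\<dots> \<le> (\<Sum>x\<in>A. k)" using assms(2) by (rule sum_mono)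
  also have "\<dots> \<le> l * k" using assms(3) by simp
  finally show ?thesis .
qed

lemma card_ball2:
  assumes "u \<in> V"
  shows "card (ball2 u) \<le> (\<Delta> + 1)\<^sup>2"
  unfolding ball2_def power2_eq_square
  using assms ball1_subset card_ball1 finite_V
  by (intro card_UN_bounded) (auto intro: finite_subset)

text \<open>If the two balls share \<open>x\<close>, then \<open>w\<close> lies in
  \<open>ball2 x\<close> with \<open>x\<close> in \<open>ball2 u\<close>, which leaves at most the
  square of \<open>(\<Delta> + 1)\<^sup>2\<close> choices. The factor \<open>UNIV\<close> covers all
  slots of a vertex.\<close>

lemma card_dependent:
  assumes u: "u \<in> V"
  shows "card {w \<in> V. ball2 u \<times> (UNIV :: nat set) \<inter> ball2 w \<times> UNIV \<noteq> {}} \<le> (\<Delta> + 1) ^ 4"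
proof -
  have fin: "finite (ball2 w)" if "w \<in> V" for w
    using ball2_subset[OF that] finite_V by (rule finite_subset)
  have "{w \<in> V. ball2 u \<times> (UNIV :: nat set) \<inter> ball2 w \<times> UNIV \<noteq> {}} \<subseteq> (\<Union>x\<in>ball2 u. ball2 x)"
    using ball2_sym by fastforce
  then have "card {w \<in> V. ball2 u \<times> (UNIV :: nat set) \<inter> ball2 w \<times> UNIV \<noteq> {}} \<le> card (\<Union>x\<in>ball2 u. ball2 x)"
    using fin ball2_subset u by (intro card_mono) auto
  also have "\<dots> \<le> (\<Delta> + 1)\<^sup>2 * (\<Delta> + 1)\<^sup>2"
    using fin[OF u] card_ball2 ball2_subset u by (intro card_UN_bounded) auto
  also have "\<dots> = (\<Delta> + 1) ^ 4" by (simp flip: power_add)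
  finally show ?thesis .
qed

text \<open>An edge at \<open>y\<close> can be picked only by \<open>y\<close> or by a neighbour of
  \<open>y\<close>, so picks made outside \<open>ball1 y\<close> never concern
  \<open>y\<close>.\<close>

lemma pick_cong:
  assumes "\<omega> \<in> \<Omega>" "\<omega>' \<in> \<Omega>" and eq: "\<And>i. i \<in> ball1 y \<times> (UNIV :: nat set) \<Longrightarrow> \<omega> i = \<omega>' i" and "p \<in> I"
  shows "y \<in> \<omega> p \<Longrightarrow> \<omega> p = \<omega>' p" "y \<in> \<omega>' p \<Longrightarrow> \<omega> p = \<omega>' p"
proof -
  have "\<omega> p = \<omega>' p" if "y \<in> \<chi> p" "\<chi> \<in> \<Omega>" for \<chi>
  proof -
    have "fst p \<in> ball1 y"
      using pick_nbhd(1)[OF that(2) \<open>p \<in> I\<close> that(1)] by (cases "fst p = y") (auto simp: ball1_def)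
    then show ?thesis using eq[of p] by (cases p) auto
  qed
  then show "y \<in> \<omega> p \<Longrightarrow> \<omega> p = \<omega>' p" "y \<in> \<omega>' p \<Longrightarrow> \<omega> p = \<omega>' p" using assms by blast+
qed

lemma in_picks_cong:
  assumes "\<omega> \<in> \<Omega>" "\<omega>' \<in> \<Omega>" and "\<And>i. i \<in> ball1 y \<times> (UNIV :: nat set) \<Longrightarrow> \<omega> i = \<omega>' i"
  shows "in_picks \<omega> y = in_picks \<omega>' y"
proof -
  have "y \<in> \<omega> p \<longleftrightarrow> y \<in> \<omega>' p" if "p \<in> I" for p
    using pick_cong[where y = y, OF assms that] by metis
  then show ?thesis by (auto simp: in_picks_def)
qed

lemma palette_cong:
  assumes "\<omega> \<in> \<Omega>" "\<omega>' \<in> \<Omega>" and "\<And>i. i \<in> ball1 y \<times> (UNIV :: nat set) \<Longrightarrow> \<omega> i = \<omega>' i"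
  shows "palette \<omega> y = palette \<omega>' y"
proof -
  have "e \<in> \<omega> ` I \<longleftrightarrow> e \<in> \<omega>' ` I" if "y \<in> e" for e
  proof
    assume "e \<in> \<omega> ` I"
    then obtain p where "p \<in> I" "e = \<omega> p" by blast
    then show "e \<in> \<omega>' ` I" using pick_cong(1)[where y = y, OF assms \<open>p \<in> I\<close>] that by simp
  next
    assume "e \<in> \<omega>' ` I"
    then obtain p where "p \<in> I" "e = \<omega>' p" by blast
    then show "e \<in> \<omega> ` I" using pick_cong(2)[where y = y, OF assms \<open>p \<in> I\<close>] that by (metis imageI)
  qed
  then have "incident_edges (E - \<omega> ` I) y = incident_edges (E - \<omega>' ` I) y"
    by (auto simp: incident_edges_def)
  then show ?thesis by (simp add: palette_def)
qed

lemma Bad_cong: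
  assumes "\<omega> \<in> Bad u" "\<omega>' \<in> \<Omega>" and eq: "\<And>i. i \<in> ball2 u \<times> (UNIV :: nat set) \<Longrightarrow> \<omega> i = \<omega>' i"
  shows "\<omega>' \<in> Bad u"
proof -
  have \<omega>: "\<omega> \<in> \<Omega>" using assms(1) by (auto simp: Bad_def crowded_def conflict_def)
  have eq1: "\<omega> i = \<omega>' i" if "y \<in> ball1 u" "i \<in> ball1 y \<times> (UNIV :: nat set)" for y i
    using that eq[of i] by (auto simp: ball2_def)
  have "in_picks \<omega> u = in_picks \<omega>' u"
    by (rule in_picks_cong[OF \<omega> assms(2)], rule eq1[of u]) (simp_all add: ball1_def)
  moreover have "palette \<omega> y = palette \<omega>' y" if "y \<in> insert u (nbhd u)" for y
    by (rule palette_cong[OF \<omega> assms(2)], rule eq1[of y]) (use that in \<open>simp_all add: ball1_def\<close>)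
  ultimately show ?thesis
    using assms(1,2) by (auto simp: Bad_def crowded_def conflict_def)
qed

lemma distinguishing_picks:
  assumes "4 * prob_bound * real ((\<Delta> + 1) ^ 4) \<le> 1" and "0 < q"
  obtains H where "H \<subseteq> E" "\<And>u. vertex_degree H u < h + q"
    "\<And>u v. {u, v} \<in> E \<Longrightarrow> c ` incident_edges (E - H) u \<noteq> c ` incident_edges (E - H) v"
proof -
  have "\<exists>\<omega>\<in>\<Omega>. \<forall>u\<in>V. \<omega> \<notin> Bad u"
  proof (rule local_lemma[of I "\<lambda>p. incident_edges E (fst p)" V Bad "\<lambda>u. ball2 u \<times> UNIV"
        prob_bound "(\<Delta> + 1) ^ 4", folded \<Omega>_def])
    show "finite (incident_edges E (fst i)) \<and> incident_edges E (fst i) \<noteq> {}" if "i \<in> I" for i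
      using deg[of "fst i"] m that finite_incident by (auto simp: I_def vertex_degree_def)
    show "\<omega>' \<in> Bad u" if "\<omega> \<in> Bad u" "\<omega>' \<in> \<Omega>" "\<And>i. i \<in> ball2 u \<times> UNIV \<Longrightarrow> \<omega> i = \<omega>' i"
      for u \<omega> \<omega>'
      using Bad_cong that by blast
    show "Bad u \<subseteq> \<Omega>" for u by (auto simp: Bad_def crowded_def conflict_def)
  qed (use finite_I finite_V card_Bad card_dependent assms in auto)
  then obtain \<omega> where \<omega>: "\<omega> \<in> \<Omega>" "\<And>u. u \<in> V \<Longrightarrow> \<omega> \<notin> Bad u" by blast
  have few: "card (in_picks \<omega> u) < q" if "u \<in> V" for u
    using \<omega>(2)[OF that] \<omega>(1) by (auto simp: Bad_def crowded_def)
  show ?thesis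
  proof (rule that[of "\<omega> ` I"])
    show "\<omega> ` I \<subseteq> E" using pick(1)[OF \<omega>(1)] by auto
    show "vertex_degree (\<omega> ` I) u < h + q" for u
    proof (cases "u \<in> V")
      case True
      then show ?thesis using degree_picks[OF \<omega>(1), of u] few by fastforce
    next
      case False
      then have "incident_edges (\<omega> ` I) u = {}"
        using pick(1)[OF \<omega>(1)] edge_subset by (auto simp: incident_edges_def)
      then show ?thesis using \<open>0 < q\<close> by (simp add: vertex_degree_def)
    qed
    show "c ` incident_edges (E - \<omega> ` I) u \<noteq> c ` incident_edges (E - \<omega> ` I) v" if "{u, v} \<in> E" for u v
    proof -
      have "u \<in> V" using edge_subset[OF that] by simp
      \<comment> \<open>As \<open>u\<close> is not crowded, \<open>conflict u v\<close> can fail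
        only through unequal palettes.\<close>
      then show ?thesis
        using \<omega> few that by (auto simp: Bad_def conflict_def palette_def nbhd_def)
    qed
  qed
qed

end

section \<open>Recolouring the picked edges\<close>

text \<open>A colour left at \<open>u\<close> but not at \<open>v\<close> lies on exactly one edge
  at \<open>u\<close>, by properness, and on none at \<open>v\<close>. It satisfies
  \<open>uv\<close>, and new colours shifted beyond \<open>k\<close> cannot repeat it.\<close>

lemma union_colouring:
  assumes simple: "simple_graph V E"
    and c: "proper_edge_colouring E c" "c ` E \<subseteq> {..k}"
    and H: "H \<subseteq> E" and g: "proper_edge_colouring H g" "g ` H \<subseteq> {..l}"
    and palettes: "\<And>u v. {u, v} \<in> E \<Longrightarrow>
      c ` incident_edges (E - H) u \<noteq> c ` incident_edges (E - H) v"
  shows "pOCF_index E \<le> k + l + 2"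
proof -
  define d where "d e = (if e \<in> H then Suc k + g e else c e)" for e
  have c_le: "c e \<le> k" if "e \<in> E" for e using c(2) that by auto
  have proper: "proper_edge_colouring E d"
    unfolding proper_edge_colouring_def
  proof (intro ballI impI)
    fix e f assume ef: "e \<in> E" "f \<in> E" "e \<noteq> f \<and> e \<inter> f \<noteq> {}"
    have "c e \<noteq> c f" using c(1) ef unfolding proper_edge_colouring_def by blast
    moreover have "g e \<noteq> g f" if "e \<in> H" "f \<in> H"
      using g(1) that ef unfolding proper_edge_colouring_def by blast
    ultimately show "d e \<noteq> d f"
      using c_le[OF ef(1)] c_le[OF ef(2)] by (auto simp: d_def)
  qed
  have satisfied: "edge_satisfied E d e" if "e = {u, v}" "e \<in> E" "a \<in> c ` incident_edges (E - H) u"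
    "a \<notin> c ` incident_edges (E - H) v" for e u v a
  proof -
    note a = that
    obtain f where f: "f \<in> E" "f \<notin> H" "u \<in> f" "c f = a"
      using a(3) by (auto simp: incident_edges_def)
    \<comment> \<open>The colour \<open>a\<close> is at most \<open>k\<close>, whereas
      \<open>d\<close> exceeds \<open>k\<close> on \<open>H\<close>.\<close>
    have d_a: "g \<notin> H \<and> c g = a" if "g \<in> E" "d g = a" for g
      using that c_le[OF f(1)] f(4) by (auto simp: d_def split: if_splits)
    have not_v: "v \<notin> g" if "g \<in> E" "d g = a" for g
    proof
      assume "v \<in> g"
      then have "c g \<in> c ` incident_edges (E - H) v"
        using d_a[OF that] that(1) unfolding incident_edges_def by blast
      then show False using d_a[OF that] a(4) by simp
    qed
    have d_f: "d f = a" using f by (simp add: d_def)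
    then have "v \<notin> f" using not_v f(1) by blast
    then have nbhd: "f \<in> open_edge_nbhd E e"
      using f a(1) by (auto simp: open_edge_nbhd_def incident_edges_def)
    have uniq: "g = f" if g: "g \<in> open_edge_nbhd E e" "d g = a" for g
    proof -
      have gE: "g \<in> E" and "u \<in> g \<or> v \<in> g"
        using g(1) a(1) by (auto simp: open_edge_nbhd_def incident_edges_def)
      then have "u \<in> g" using not_v[OF gE g(2)] by blast
      then show ?thesis
        by (rule proper_edge_colouringD[OF proper gE f(1) _ f(3)]) (simp add: g(2) d_f)
    qed
    show ?thesis
      unfolding edge_satisfied_def
    proof (intro exI ex1I)
      show "f \<in> open_edge_nbhd E e \<and> d f = a" using nbhd d_f by simp
      show "g = f" if "g \<in> open_edge_nbhd E e \<and> d g = a" for g using uniq that by simp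
    qed
  qed
  have "open_conflict_free E d"
    unfolding open_conflict_free_def
  proof (intro ballI impI)
    fix e assume e: "e \<in> E"
    then have "card e = 2" using simple by (simp add: simple_graph_def)
    then obtain u v where uv: "e = {u, v}" by (auto simp: card_2_iff)
    then have "c ` incident_edges (E - H) u \<noteq> c ` incident_edges (E - H) v" using palettes e by simp
    then consider a where "a \<in> c ` incident_edges (E - H) u" "a \<notin> c ` incident_edges (E - H) v"
      | a where "a \<in> c ` incident_edges (E - H) v" "a \<notin> c ` incident_edges (E - H) u" by blast
    then show "edge_satisfied E d e"
    proof cases
      case 1
      then show ?thesis using satisfied[OF uv e] by blast
    next
      case 2
      then show ?thesis using satisfied[of e v u] uv e by (simp add: insert_commute)
    qed
  qed
  then have "pOCF_index E \<le> card (d ` E)"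
    unfolding pOCF_index_def using proper by (intro Least_le) blast
  also have "d e \<le> k + l + 1" if "e \<in> E" for e
    using c_le[OF that] g(2) by (auto simp: d_def)
  then have "card (d ` E) \<le> card {..k + l + 1}" by (intro card_mono) auto
  finally show ?thesis by simp
qed

section \<open>Estimates for large \<Delta> and the choice of the threshold\<close>

lemma eventually_local_lemma_condition:
  "\<forall>\<^sub>F \<Delta> in sequentially. \<forall>m q. real q + 7 \<le> 2 * log 2 (real \<Delta>) \<and> 2 * log 2 (real \<Delta>) \<le> real q + 8 \<and> \<Delta> \<le> 2 * m \<longrightarrow>
    4 * (real (6 * \<Delta>) ^ q / (real m ^ q * fact q) + real \<Delta> * (real (6 + q) / real m) ^ 6) * real ((\<Delta> + 1) ^ 4) \<le> 1"
proof -
  \<comment> \<open>Here 192 = 12 * 16: the ratio \<open>6 * \<Delta> / m\<close> is at most 12, and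
    \<open>(\<Delta> + 1) ^ 4\<close> is at most \<open>2 ^ 32 * 16 ^ q\<close>. The bound
    \<open>1 / 2 ^ 35\<close> absorbs 4 * 2 ^ 32 and leaves 1 / 2.\<close>
  have "(\<lambda>q. 192 ^ q / fact q :: real) \<longlonglongrightarrow> 0"
    using summable_LIMSEQ_zero[OF summable_exp[of "192 :: real"]] by (simp add: divide_inverse mult.commute)
  then have "\<forall>\<^sub>F q in sequentially. 192 ^ q / fact q < (1 / 2 ^ 35 :: real)"
    by (rule order_tendstoD) simp
  then obtain q0 where q0: "\<And>q. q \<ge> q0 \<Longrightarrow> 192 ^ q / fact q < (1 / 2 ^ 35 :: real)"
    by (auto simp: eventually_sequentially)
  \<comment> \<open>The conflict term, with \<open>6 + q\<close> and \<open>m\<close> replaced by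
    their bounds, is of order (log x) ^ 6 / x.\<close>
  have "\<forall>\<^sub>F x :: real in at_top. 4 * (x * (2 * log 2 x / (x / 2)) ^ 6) * (x + 1) ^ 4 \<le> 1 / 2"
    by real_asymp
  then have "\<forall>\<^sub>F \<Delta> :: nat in sequentially.
      4 * (\<Delta> * (2 * log 2 \<Delta> / (\<Delta> / 2)) ^ 6) * (real \<Delta> + 1) ^ 4 \<le> 1 / 2"
    by (rule eventually_compose_filterlim[OF _ filterlim_real_sequentially])
  moreover have "\<forall>\<^sub>F x :: real in at_top. 2 * log 2 x \<ge> q0 + 8"
    by real_asymp
  then have "\<forall>\<^sub>F \<Delta> :: nat in sequentially. 2 * log 2 \<Delta> \<ge> q0 + 8"
    by (rule eventually_compose_filterlim[OF _ filterlim_real_sequentially])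
  ultimately show ?thesis
    using eventually_ge_at_top[of 2]
  proof eventually_elim
    case (elim \<Delta>)
    show ?case
    proof (intro allI impI, elim conjE)
      fix m q :: nat
      assume q: "real q + 7 \<le> 2 * log 2 \<Delta>" "2 * log 2 \<Delta> \<le> real q + 8" and m: "\<Delta> \<le> 2 * m"
      have m0: "real m > 0" and mD: "real \<Delta> / 2 \<le> real m" using m elim by auto
      have "real \<Delta> ^ 2 = 2 powr (2 * log 2 \<Delta>)"
        using elim by (simp add: powr_powr[symmetric] powr_realpow mult.commute[of 2])
      also have "\<dots> \<le> 2 powr (real (q + 8))" using q by (intro powr_mono) auto
      also have "\<dots> = 2 ^ (q + 8)" by (rule powr_realpow) simp
      finally have sq: "real \<Delta> ^ 2 \<le> 2 ^ (q + 8)" .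
      \<comment> \<open>Since \<Delta> + 1 \<le> \<open>\<Delta>\<^sup>2\<close> \<le>
        \<open>2 ^ (q + 8)\<close>, the number of dependent events is bounded exponentially in
        \<open>q\<close>, which the factorial outweighs.\<close>
      have "real \<Delta> + 1 \<le> real \<Delta> * 2" using elim by simp
      also have "\<dots> \<le> real \<Delta> * real \<Delta>" using elim by (intro mult_left_mono) auto
      finally have "(real \<Delta> + 1) ^ 4 \<le> (2 ^ (q + 8)) ^ 4"
        using sq by (intro power_mono) (auto simp: power2_eq_square)
      also have "\<dots> = 2 ^ 32 * (16 :: real) ^ q"
        by (simp add: power_add power_mult_distrib flip: power_mult) (simp add: power_mult mult.commute[of q])
      finally have D4: "(real \<Delta> + 1) ^ 4 \<le> 2 ^ 32 * 16 ^ q" .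
      have "real (6 * \<Delta>) ^ q \<le> (12 * real m) ^ q" using mD by (intro power_mono) auto
      then have "real (6 * \<Delta>) ^ q / (real m ^ q * fact q) \<le> (12 * real m) ^ q / (real m ^ q * fact q)"
        by (intro divide_right_mono) auto
      also have "\<dots> = 12 ^ q / fact q" using m0 by (simp add: power_mult_distrib)
      finally have "4 * (real (6 * \<Delta>) ^ q / (real m ^ q * fact q)) * (real \<Delta> + 1) ^ 4
          \<le> 4 * (12 ^ q / fact q) * (2 ^ 32 * 16 ^ q)"
        using D4 by (intro mult_mono) auto
      also have "\<dots> = 2 ^ 34 * (192 ^ q / fact q)" by (simp add: power_mult_distrib[symmetric])
      also have "\<dots> \<le> 1 / 2" using q0[of q] q elim by simp
      finally have 1: "4 * (real (6 * \<Delta>) ^ q / (real m ^ q * fact q)) * (real \<Delta> + 1) ^ 4 \<le> 1 / 2" .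
      have "real (6 + q) / real m \<le> 2 * log 2 \<Delta> / (\<Delta> / 2)"
        using q mD elim by (intro frac_le) auto
      then have "4 * (real \<Delta> * (real (6 + q) / real m) ^ 6) * (real \<Delta> + 1) ^ 4
          \<le> 4 * (\<Delta> * (2 * log 2 \<Delta> / (\<Delta> / 2)) ^ 6) * (real \<Delta> + 1) ^ 4"
        by (intro mult_right_mono mult_left_mono power_mono) auto
      also have "\<dots> \<le> 1 / 2" by (fact elim)
      finally have 2: "4 * (real \<Delta> * (real (6 + q) / real m) ^ 6) * (real \<Delta> + 1) ^ 4 \<le> 1 / 2" .
      have "4 * (real (6 * \<Delta>) ^ q / (real m ^ q * fact q) + real \<Delta> * (real (6 + q) / real m) ^ 6) * real ((\<Delta> + 1) ^ 4)
        = 4 * (real (6 * \<Delta>) ^ q / (real m ^ q * fact q)) * (real \<Delta> + 1) ^ 4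
          + 4 * (real \<Delta> * (real (6 + q) / real m) ^ 6) * (real \<Delta> + 1) ^ 4"
        by (simp only: of_nat_power of_nat_add of_nat_1 distrib_left distrib_right)
      also have "\<dots> \<le> 1" using 1 2 by linarith
      finally show "4 * (real (6 * \<Delta>) ^ q / (real m ^ q * fact q) + real \<Delta> * (real (6 + q) / real m) ^ 6) * real ((\<Delta> + 1) ^ 4) \<le> 1" .
    qed
  qed
qed

theorem theorem12:
  shows "\<exists>\<Delta>\<^sub>0 :: nat. \<forall>(V :: 'a set) (E :: 'a set set) (\<Delta> :: nat).
    simple_graph V E \<and> V \<noteq> {} \<and> \<Delta> = max_degree V E \<and> \<Delta> \<ge> \<Delta>\<^sub>0 \<and>
    real (min_degree V E) \<ge> real \<Delta> - 2 * sqrt (real \<Delta>) * log 2 (real \<Delta>)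
    \<longrightarrow> real (pOCF_index E) \<le> real \<Delta> + 2 * log 2 (real \<Delta>)"
proof -
  \<comment> \<open>The first condition turns the degree hypothesis into
    \<open>\<Delta> \<le> 2 * m\<close>; the second makes \<open>q\<close> positive.\<close>
  have "\<forall>\<^sub>F x :: real in at_top. 2 * sqrt x * log 2 x \<le> x / 2 \<and> 2 * log 2 x \<ge> 8 \<and> x > 0"
    by (intro eventually_conj; real_asymp)
  then have "\<forall>\<^sub>F \<Delta> :: nat in sequentially. 2 * sqrt \<Delta> * log 2 \<Delta> \<le> \<Delta> / 2 \<and> 2 * log 2 \<Delta> \<ge> 8 \<and> real \<Delta> > 0"
    by (rule eventually_compose_filterlim[OF _ filterlim_real_sequentially])
  from eventually_conj[OF this eventually_local_lemma_condition] obtain \<Delta>0 where \<Delta>0: "\<And>\<Delta>. \<Delta> \<ge> \<Delta>0 \<Longrightarrow>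
      2 * sqrt \<Delta> * log 2 \<Delta> \<le> \<Delta> / 2 \<and> 2 * log 2 \<Delta> \<ge> 8 \<and> real \<Delta> > 0"
    "\<And>\<Delta> m q. \<Delta> \<ge> \<Delta>0 \<Longrightarrow> real q + 7 \<le> 2 * log 2 (real \<Delta>) \<Longrightarrow> 2 * log 2 (real \<Delta>) \<le> real q + 8 \<Longrightarrow> \<Delta> \<le> 2 * m \<Longrightarrow>
      4 * (real (6 * \<Delta>) ^ q / (real m ^ q * fact q) + real \<Delta> * (real (6 + q) / real m) ^ 6) * real ((\<Delta> + 1) ^ 4) \<le> 1"
    unfolding eventually_sequentially by blast
  have "real (pOCF_index E) \<le> real \<Delta> + 2 * log 2 (real \<Delta>)"
    if simple: "simple_graph V E" and "V \<noteq> {}" and \<Delta>: "\<Delta> = max_degree V E" "\<Delta> \<ge> \<Delta>0"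
      and \<delta>: "real (min_degree V E) \<ge> real \<Delta> - 2 * sqrt (real \<Delta>) * log 2 (real \<Delta>)"
    for V :: "'a set" and E :: "'a set set" and \<Delta> :: nat
  proof -
    define m where "m = min_degree V E"
    \<comment> \<open>The largest value within the budget: \<Delta> + 1 old colours and
      \<open>6 + q\<close> new ones make \<Delta> + q + 7.\<close>
    define q where "q = nat (\<lfloor>2 * log 2 (real \<Delta>)\<rfloor> - 7)"
    note large = \<Delta>0(1)[OF \<Delta>(2)]
    have m: "\<Delta> \<le> 2 * m" "0 < m" using large \<delta> by (simp_all add: m_def)
    have q: "real q + 7 \<le> 2 * log 2 \<Delta>" "2 * log 2 \<Delta> \<le> real q + 8" "0 < q"
      using large by (simp_all add: q_def) linarith+
    have finV: "finite V" and finE: "finite E" and card_E: "\<And>e. e \<in> E \<Longrightarrow> card e = 2"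
      using simple finite_subset[of E "Pow V"] by (auto simp: simple_graph_def)
    have deg: "m \<le> vertex_degree E x \<and> vertex_degree E x \<le> \<Delta>" if "x \<in> V" for x
      using that finV by (simp add: m_def \<Delta>(1) min_degree_def max_degree_def)
    have deg': "vertex_degree E x \<le> \<Delta>" for x
    proof (cases "x \<in> V")
      case False
      then have "incident_edges E x = {}" using simple by (auto simp: simple_graph_def incident_edges_def)
      then show ?thesis by (simp add: vertex_degree_def)
    qed (use deg in blast)
    obtain c where c: "proper_edge_colouring E c" "c ` E \<subseteq> {..\<Delta>}"
      using vizing[OF finE card_E deg'] by blast
    interpret picks: random_picks V E c 6 q m \<Delta>
      using simple c(1) deg m(2) by unfold_locales
    have "4 * picks.prob_bound * real ((\<Delta> + 1) ^ 4) \<le> 1"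
      unfolding picks.prob_bound_def by (rule \<Delta>0(2)[OF \<Delta>(2) q(1,2) m(1)])
    then obtain H where H: "H \<subseteq> E" "\<And>u. vertex_degree H u < 6 + q"
      "\<And>u v. {u, v} \<in> E \<Longrightarrow> c ` incident_edges (E - H) u \<noteq> c ` incident_edges (E - H) v"
      using picks.distinguishing_picks[OF _ q(3)] by blast
    \<comment> \<open>\<open>H\<close> has degrees at most \<open>5 + q\<close>, so Vizing's theorem
      needs the \<open>6 + q\<close> colours of \<open>{..5 + q}\<close>.\<close>
    have "finite H" "\<And>e. e \<in> H \<Longrightarrow> card e = 2" "\<And>u. vertex_degree H u \<le> 5 + q"
      using H(1,2) finE finite_subset card_E by (auto simp: less_Suc_eq_le numeral_eq_Suc)
    then obtain g where "proper_edge_colouring H g" "g ` H \<subseteq> {..5 + q}"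
      using vizing by blast
    then have "pOCF_index E \<le> \<Delta> + (5 + q) + 2"
      using union_colouring[OF simple c H(1) _ _ H(3)] by blast
    then show ?thesis using q(1) by linarith
  qed
  then show ?thesis by (intro exI[of _ \<Delta>0]) blast
qed

end
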